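(* Let $\bar\theta\in\mathrm{cl}(\mathcal D_{\mathrm{KKT}})$ and let $U\subset\mathcal D$ be compact with $\bar\theta\in U$. (a) (ADMM and sGS-ADMM) Fix $\sigma>0$, $\tau\in(0,2)$, and suppose there is $\kappa_U>0$ with $\mathcal A\mathcal A^*\succeq\kappa_U\mathrm{Id}$ for all $\theta=(\mathcal A,b,c)\in U$. Let $\mathcal H:=\mathcal X$ and $$T_\theta z:=z-P_{\mathcal A}[\Pi_{\mathcal K}(z)-\mathcal A^\dagger b]-\tau P_{\mathcal A}^\perp[-\Pi_{\mathcal K^*}(-z)+\sigma c].$$ Then for every $\theta\in U$, both for the ADMM iterates and for the sGS-ADMM iterates, the sequence $z^{(k)}:=P_{\mathcal A}^\perp x^{(k)}+\mathcal A^\dagger b-\sigma P_{\mathcal A}s^{(k)}-\sigma P_{\mathcal A}^\perp c$ satisfies $z^{(k+1)}=T_\theta z^{(k)}$ for all $k\ge0$. Moreover $\{T_\theta\}_{\theta\in U}$ satisfies the standing assumptions (i)–(iv) of the context with $G_\theta=P_{\mathcal A}+\tau^{-1}P_{\mathcal A}^\perp$, $\alpha_\theta=\tfrac12\max\{1,\tau\}$, $m_U=\min\{1,\tau^{-1}\}$, $M_U=\max\{1,\tau^{-1}\}$. (b) (PDHG) Fix $\eta_x,\eta_y>0$ and suppose $\gamma_U:=\sup_{\theta\in U}\sqrt{\eta_x\eta_y}\,\|\mathcal A\|_{\mathrm{op}}<1$. Let $\mathcal H:=\mathcal X\times\mathcal Y$ and, for $z=(x,y)$, $$T_\theta z:=\big(x^+,\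 y+\eta_y[b-\mathcal A(2x^+-x)]\big),\qquad x^+:=\Pi_{\mathcal K}[x-\eta_x(c-\mathcal A^*y)].$$ Then $\{T_\theta\}_{\theta\in U}$ satisfies the standing assumptions (i)–(iv) with $G_\theta=\begin{bmatrix}\eta_x^{-1}\mathrm{Id}_{\mathcal X}&\mathcal A^*\\\mathcal A&\eta_y^{-1}\mathrm{Id}_{\mathcal Y}\end{bmatrix}$, $\alpha_\theta=\tfrac12$, $m_U=(1-\gamma_U)\max\{\eta_x,\eta_y\}^{-1}$, $M_U=(1+\gamma_U)\min\{\eta_x,\eta_y\}^{-1}$.
   Context: **Setting.** $\mathcal X,\mathcal Y$ are finite-dimensional real Euclidean (Hilbert) spaces, $\mathcal K\subseteq\mathcal X$ is a closed convex cone with dual cone $\mathcal K^*$; $\Pi_C$ is the Euclidean projection onto a closed convex set $C$. A parameter is $\theta=(\mathcal A,b,c)\in\mathcal D:=\mathcal L(\mathcal X,\mathcal Y)\times\mathcal Y\times\mathcal X$ (with $\mathcal L(\mathcal X,\mathcal Y)$ the linear maps), normed by $\|\theta\|_{\mathcal D}^2:=\|\mathcal A\|_{\mathrm{HS}}^2+\|b\|_{\mathcal Y}^2+\|c\|_{\mathcal X}^2$. Put $\mathrm{KKT}(\theta):=\{(x,y,s):\mathcal Ax=b,\ \mathcal A^*y+s=c,\ \langle x,s\rangle_{\mathcal X}=0,\ x\in\mathcal K,\ s\in\mathcal K^*\}$ and $\mathcal D_{\mathrm{KKT}}:=\{\theta\in\mathcal D:\mathrm{KKT}(\theta)\ne\emptyset\}$.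 When $\mathcal A\mathcal A^*\succ0$: $\mathcal A^\dagger:=\mathcal A^*(\mathcal A\mathcal A^* )^{-1}$, $P_{\mathcal A}:=\mathcal A^\dagger\mathcal A$ (orthogonal projection onto $\mathrm{ran}(\mathcal A^* )$), $P_{\mathcal A}^\perp:=\mathrm{Id}-P_{\mathcal A}$. $\mathrm{Fix}(T)$ is the fixed point set of $T$. **Standing assumptions** for a family of maps $T_\theta:\mathcal H\to\mathcal H$, $\theta\in U$. (i) For every $\theta\in U$: $\mathrm{Fix}(T_\theta)\ne\emptyset$ iff $\theta\in\mathcal D_{\mathrm{KKT}}$. (ii) For every $\theta\in U$, $T_\theta$ is $\alpha_\theta$-averaged, $\alpha_\theta\in(0,1)$ (i.e. $T_\theta=(1-\alpha_\theta)\mathrm{Id}+\alpha_\theta N_\theta$ with $N_\theta$ nonexpansive) with respect to the inner product $\langle z,w\rangle_\theta:=\langle z,G_\theta w\rangle_{\mathcal H}$, $G_\theta$ self-adjoint positive definite on $\mathcal H$. (iii) $0<m_U\le M_U<\infty$ and $m_U\mathrm{Id}\preceq G_\theta\preceq M_U\mathrm{Id}$ for all $\theta\in U$. (iv) There is $L_U(r)=a+a'r$ with $a,a'\ge0$ such that $\|T_\theta z-T_{\theta'}z\|_{\mathcal H}\le L_U(\|z\|_{\mathcal H})\,\|\theta-\theta'\|_{\mathcal D}$ for all $\theta,\theta'\in U$, $z\in\mathcal H$. **ADMM iteration** (from arbitrary $x^{(0)},s^{(0)}\in\mathcal X$): $y^{(k+1)}=(\mathcal A\mathcal A^* )^{-1}[\sigma^{-1}b-\mathcal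 A(\sigma^{-1}x^{(k)}+s^{(k)}-c)]$; $s^{(k+1)}=\Pi_{\mathcal K^*}(c-\mathcal A^*y^{(k+1)}-\sigma^{-1}x^{(k)})$; $x^{(k+1)}=x^{(k)}+\tau\sigma(\mathcal A^*y^{(k+1)}+s^{(k+1)}-c)$. **sGS-ADMM iteration** (from arbitrary $x^{(0)},s^{(0)}\in\mathcal X$): $y^{(k+1/2)}=(\mathcal A\mathcal A^* )^{-1}[\sigma^{-1}b-\mathcal A(\sigma^{-1}x^{(k)}+s^{(k)}-c)]$; $s^{(k+1)}=\Pi_{\mathcal K^*}(c-\mathcal A^*y^{(k+1/2)}-\sigma^{-1}x^{(k)})$; $y^{(k+1)}=(\mathcal A\mathcal A^* )^{-1}[\sigma^{-1}b-\mathcal A(\sigma^{-1}x^{(k)}+s^{(k+1)}-c)]$; $x^{(k+1)}=x^{(k)}+\tau\sigma(\mathcal A^*y^{(k+1)}+s^{(k+1)}-c)$. *)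

theory Defs
  imports "HOL-Analysis.Analysis"
begin

definition self_adjoint :: "('a::euclidean_space \<Rightarrow> 'a) \<Rightarrow> bool" where
  "self_adjoint G \<longleftrightarrow> linear G \<and> adjoint G = G"

definition psd :: "('a::euclidean_space \<Rightarrow> 'a) \<Rightarrow> bool" where
  "psd G \<longleftrightarrow> self_adjoint G \<and> (\<forall>z. 0 \<le> z \<bullet> G z)"

definition pos_def :: "('a::euclidean_space \<Rightarrow> 'a) \<Rightarrow> bool" where
  "pos_def G \<longleftrightarrow> self_adjoint G \<and> (\<forall>z. z \<noteq> 0 \<longrightarrow> 0 < z \<bullet> G z)"

definition loewner_le ::
    "('a::euclidean_space \<Rightarrow> 'a) \<Rightarrow> ('a \<Rightarrow> 'a) \<Rightarrow> bool" (infix "\<preceq>\<^sub>L" 50) where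
  "S \<preceq>\<^sub>L T \<longleftrightarrow> psd (\<lambda>z. T z - S z)"

text \<open>\<open>op_pinv A\<close> is the right inverse \<open>A\<^sup>*(A A\<^sup>*)\<^sup>-\<^sup>1\<close>; \<open>gram_inv A\<close> is only
  meaningful if \<open>A A\<^sup>*\<close> is bijective, e.g. positive definite.\<close>

definition gram :: "('x::euclidean_space \<Rightarrow>\<^sub>L 'y::euclidean_space) \<Rightarrow> 'y \<Rightarrow> 'y" where
  "gram A y = A (adjoint A y)"

definition gram_inv :: "('x::euclidean_space \<Rightarrow>\<^sub>L 'y::euclidean_space) \<Rightarrow> 'y \<Rightarrow> 'y" where
  "gram_inv A = inv (gram A)"

definition op_pinv :: "('x::euclidean_space \<Rightarrow>\<^sub>L 'y::euclidean_space) \<Rightarrow> 'y \<Rightarrow> 'x" where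
  "op_pinv A y = adjoint A (gram_inv A y)"

definition P_ran :: "('x::euclidean_space \<Rightarrow>\<^sub>L 'y::euclidean_space) \<Rightarrow> 'x \<Rightarrow> 'x" where
  "P_ran A x = op_pinv A (A x)"

definition P_perp :: "('x::euclidean_space \<Rightarrow>\<^sub>L 'y::euclidean_space) \<Rightarrow> 'x \<Rightarrow> 'x" where
  "P_perp A x = x - P_ran A x"

type_synonym ('x, 'y) param = "('x \<Rightarrow>\<^sub>L 'y) \<times> 'y \<times> 'x"

definition hs_norm :: "('x::euclidean_space \<Rightarrow>\<^sub>L 'y::euclidean_space) \<Rightarrow> real" where
  "hs_norm A = sqrt (\<Sum>i\<in>Basis. (norm (A i))\<^sup>2)"

fun param_norm :: "('x::euclidean_space, 'y::euclidean_space) param \<Rightarrow> real" where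
  "param_norm (A, b, c) = sqrt ((hs_norm A)\<^sup>2 + (norm b)\<^sup>2 + (norm c)\<^sup>2)"

text \<open>The library norm on \<open>'x \<Rightarrow>\<^sub>L 'y\<close> is the operator norm, so the norm of the product type
  \<open>param\<close> differs from \<open>param_norm\<close>. By the following equivalence of the two norms the
  type's \<open>closure\<close> and \<open>compact\<close> are nevertheless those of \<open>param_norm\<close>.\<close>

lemma norm_le_param_norm: "norm \<theta> \<le> param_norm \<theta>"
  and param_norm_le_norm:
    "param_norm \<theta> \<le> sqrt (real DIM('x)) * norm (\<theta> :: ('x::euclidean_space, 'y::euclidean_space) param)"
proof -
  obtain A b c where \<theta>: "\<theta> = (A, b, c)" by (metis surj_pair)
  have sq: "(hs_norm A)\<^sup>2 = (\<Sum>i\<in>Basis. (norm (A i))\<^sup>2)"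
    by (simp add: hs_norm_def sum_nonneg)
  have "norm (A x) \<le> hs_norm A * norm x" for x
  proof -
    have "norm (A x) = norm (\<Sum>i\<in>Basis. (x \<bullet> i) *\<^sub>R A i)"
      by (metis (no_types, lifting) blinfun.scaleR_right blinfun.sum_right
          euclidean_representation sum.cong)
    also have "\<dots> \<le> (\<Sum>i\<in>Basis. \<bar>x \<bullet> i\<bar> * norm (A i))"
      by (rule order_trans[OF norm_sum]) simp
    also have "\<dots> \<le> L2_set (\<lambda>i. x \<bullet> i) Basis * L2_set (\<lambda>i. norm (A i)) Basis"
      using L2_set_mult_ineq[of "\<lambda>i. x \<bullet> i" "\<lambda>i. norm (A i)" Basis] by simp
    also have "\<dots> = hs_norm A * norm x"
      by (simp add: hs_norm_def L2_set_def norm_eq_sqrt_inner euclidean_inner[of x x]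
          power2_eq_square mult.commute)
    finally show ?thesis .
  qed
  then have "norm A \<le> hs_norm A"
    by (intro norm_blinfun_bound) (simp_all add: hs_norm_def sum_nonneg)
  then have "(norm A)\<^sup>2 \<le> (hs_norm A)\<^sup>2"
    by (simp add: power_mono)
  then show "norm \<theta> \<le> param_norm \<theta>"
    by (simp add: \<theta> norm_Pair)
  have "(hs_norm A)\<^sup>2 \<le> (\<Sum>i\<in>(Basis::'x set). (norm A)\<^sup>2)"
    unfolding sq
  proof (intro sum_mono power_mono norm_ge_zero)
    fix i :: 'x assume "i \<in> Basis"
    then show "norm (A i) \<le> norm A" using norm_blinfun[of A i] by simp
  qed
  also have "\<dots> = real DIM('x) * (norm A)\<^sup>2" by simp
  finally have "(hs_norm A)\<^sup>2 \<le> real DIM('x) * (norm A)\<^sup>2" .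
  moreover have "1 * t \<le> real DIM('x) * t" if "0 \<le> t" for t
    using that by (intro mult_right_mono) (simp_all add: Suc_leI)
  from this[of "(norm b)\<^sup>2 + (norm c)\<^sup>2"]
  have "(norm b)\<^sup>2 + (norm c)\<^sup>2 \<le> real DIM('x) * ((norm b)\<^sup>2 + (norm c)\<^sup>2)" by simp
  ultimately have "(hs_norm A)\<^sup>2 + (norm b)\<^sup>2 + (norm c)\<^sup>2
      \<le> real DIM('x) * ((norm A)\<^sup>2 + ((norm b)\<^sup>2 + (norm c)\<^sup>2))"
    by (simp add: distrib_left)
  then show "param_norm \<theta> \<le> sqrt (real DIM('x)) * norm \<theta>"
    by (simp add: \<theta> norm_Pair real_sqrt_mult[symmetric])
qed

definition dual_cone :: "'x::euclidean_space set \<Rightarrow> 'x set" where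
  "dual_cone K = {s. \<forall>x\<in>K. 0 \<le> x \<bullet> s}"

fun KKT :: "'x::euclidean_space set \<Rightarrow> ('x, 'y::euclidean_space) param \<Rightarrow> ('x \<times> 'y \<times> 'x) set" where
  "KKT K (A, b, c) =
     {(x, y, s). A x = b \<and> adjoint A y + s = c \<and> x \<bullet> s = 0 \<and> x \<in> K \<and> s \<in> dual_cone K}"

definition D_KKT :: "'x::euclidean_space set \<Rightarrow> ('x, 'y::euclidean_space) param set" where
  "D_KKT K = {\<theta>. KKT K \<theta> \<noteq> {}}"

definition Fix :: "('h \<Rightarrow> 'h) \<Rightarrow> 'h set" where
  "Fix T = {z. T z = z}"

definition weighted_norm :: "('h::euclidean_space \<Rightarrow> 'h) \<Rightarrow> 'h \<Rightarrow> real" where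
  "weighted_norm G z = sqrt (z \<bullet> G z)"

definition nonexpansive_wrt :: "('h::euclidean_space \<Rightarrow> 'h) \<Rightarrow> ('h \<Rightarrow> 'h) \<Rightarrow> bool" where
  "nonexpansive_wrt G N \<longleftrightarrow> (\<forall>z w. weighted_norm G (N z - N w) \<le> weighted_norm G (z - w))"

definition averaged_wrt :: "('h::euclidean_space \<Rightarrow> 'h) \<Rightarrow> real \<Rightarrow> ('h \<Rightarrow> 'h) \<Rightarrow> bool" where
  "averaged_wrt G \<alpha> T \<longleftrightarrow>
     (\<exists>N. nonexpansive_wrt G N \<and> (\<forall>z. T z = (1 - \<alpha>) *\<^sub>R z + \<alpha> *\<^sub>R N z))"

definition standing_assumptions ::
    "'x::euclidean_space set \<Rightarrow> ('x, 'y::euclidean_space) param set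
      \<Rightarrow> (('x, 'y) param \<Rightarrow> 'h::euclidean_space \<Rightarrow> 'h) \<Rightarrow> (('x, 'y) param \<Rightarrow> 'h \<Rightarrow> 'h)
      \<Rightarrow> (('x, 'y) param \<Rightarrow> real) \<Rightarrow> real \<Rightarrow> real \<Rightarrow> bool" where
  "standing_assumptions K U T G \<alpha> m M \<longleftrightarrow>
     (\<forall>\<theta>\<in>U. Fix (T \<theta>) \<noteq> {} \<longleftrightarrow> \<theta> \<in> D_KKT K) \<and>
     (\<forall>\<theta>\<in>U. 0 < \<alpha> \<theta> \<and> \<alpha> \<theta> < 1 \<and> pos_def (G \<theta>) \<and> averaged_wrt (G \<theta>) (\<alpha> \<theta>) (T \<theta>)) \<and>
     (0 < m \<and> m \<le> M \<and> (\<forall>\<theta>\<in>U. (\<lambda>z. m *\<^sub>R z) \<preceq>\<^sub>L G \<theta> \<and> G \<theta> \<preceq>\<^sub>L (\<lambda>z. M *\<^sub>R z))) \<and>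
     (\<exists>a\<ge>0. \<exists>a'\<ge>0. \<forall>\<theta>\<in>U. \<forall>\<theta>'\<in>U. \<forall>z.
        norm (T \<theta> z - T \<theta>' z) \<le> (a + a' * norm z) * param_norm (\<theta> - \<theta>'))"

fun T_admm :: "'x::euclidean_space set \<Rightarrow> real \<Rightarrow> real
    \<Rightarrow> ('x, 'y::euclidean_space) param \<Rightarrow> 'x \<Rightarrow> 'x" where
  "T_admm K \<sigma> \<tau> (A, b, c) z =
     z - P_ran A (closest_point K z - op_pinv A b)
       - \<tau> *\<^sub>R P_perp A (- closest_point (dual_cone K) (- z) + \<sigma> *\<^sub>R c)"

fun G_admm :: "real \<Rightarrow> ('x::euclidean_space, 'y::euclidean_space) param \<Rightarrow> 'x \<Rightarrow> 'x" where
  "G_admm \<tau> (A, b, c) z = P_ran A z + inverse \<tau> *\<^sub>R P_perp A z"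

fun y_update :: "real \<Rightarrow> ('x::euclidean_space, 'y::euclidean_space) param \<Rightarrow> 'x \<Rightarrow> 'x \<Rightarrow> 'y" where
  "y_update \<sigma> (A, b, c) x s = gram_inv A (inverse \<sigma> *\<^sub>R b - A (inverse \<sigma> *\<^sub>R x + s - c))"

fun s_update :: "'x::euclidean_space set \<Rightarrow> real \<Rightarrow> ('x, 'y::euclidean_space) param
    \<Rightarrow> 'x \<Rightarrow> 'y \<Rightarrow> 'x" where
  "s_update K \<sigma> (A, b, c) x y =
     closest_point (dual_cone K) (c - adjoint A y - inverse \<sigma> *\<^sub>R x)"

fun x_update :: "real \<Rightarrow> real \<Rightarrow> ('x::euclidean_space, 'y::euclidean_space) param
    \<Rightarrow> 'x \<Rightarrow> 'y \<Rightarrow> 'x \<Rightarrow> 'x" where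
  "x_update \<sigma> \<tau> (A, b, c) x y s = x + (\<tau> * \<sigma>) *\<^sub>R (adjoint A y + s - c)"

text \<open>The initial points \<open>x 0\<close>, \<open>s 0\<close> are unconstrained and \<open>y 0\<close> is never used.
  In \<open>sgs_admm_iterates\<close>, \<open>yh k\<close> stands for \<open>y\<^sup>(\<^sup>k\<^sup>+\<^sup>1\<^sup>/\<^sup>2\<^sup>)\<close>.\<close>

definition admm_iterates :: "'x::euclidean_space set \<Rightarrow> real \<Rightarrow> real
    \<Rightarrow> ('x, 'y::euclidean_space) param
    \<Rightarrow> (nat \<Rightarrow> 'x) \<Rightarrow> (nat \<Rightarrow> 'y) \<Rightarrow> (nat \<Rightarrow> 'x) \<Rightarrow> bool" where
  "admm_iterates K \<sigma> \<tau> \<theta> x y s \<longleftrightarrow>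
     (\<forall>k. y (Suc k) = y_update \<sigma> \<theta> (x k) (s k) \<and>
          s (Suc k) = s_update K \<sigma> \<theta> (x k) (y (Suc k)) \<and>
          x (Suc k) = x_update \<sigma> \<tau> \<theta> (x k) (y (Suc k)) (s (Suc k)))"

definition sgs_admm_iterates :: "'x::euclidean_space set \<Rightarrow> real \<Rightarrow> real
    \<Rightarrow> ('x, 'y::euclidean_space) param
    \<Rightarrow> (nat \<Rightarrow> 'x) \<Rightarrow> (nat \<Rightarrow> 'y) \<Rightarrow> (nat \<Rightarrow> 'y) \<Rightarrow> (nat \<Rightarrow> 'x) \<Rightarrow> bool" where
  "sgs_admm_iterates K \<sigma> \<tau> \<theta> x yh y s \<longleftrightarrow>
     (\<forall>k. yh k = y_update \<sigma> \<theta> (x k) (s k) \<and>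
          s (Suc k) = s_update K \<sigma> \<theta> (x k) (yh k) \<and>
          y (Suc k) = y_update \<sigma> \<theta> (x k) (s (Suc k)) \<and>
          x (Suc k) = x_update \<sigma> \<tau> \<theta> (x k) (y (Suc k)) (s (Suc k)))"

fun z_admm :: "real \<Rightarrow> ('x::euclidean_space, 'y::euclidean_space) param \<Rightarrow> 'x \<Rightarrow> 'x \<Rightarrow> 'x" where
  "z_admm \<sigma> (A, b, c) x s =
     P_perp A x + op_pinv A b - \<sigma> *\<^sub>R P_ran A s - \<sigma> *\<^sub>R P_perp A c"

fun T_pdhg :: "'x::euclidean_space set \<Rightarrow> real \<Rightarrow> real
    \<Rightarrow> ('x, 'y::euclidean_space) param \<Rightarrow> 'x \<times> 'y \<Rightarrow> 'x \<times> 'y" where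
  "T_pdhg K \<eta>x \<eta>y (A, b, c) (x, y) =
     (let x' = closest_point K (x - \<eta>x *\<^sub>R (c - adjoint A y))
      in (x', y + \<eta>y *\<^sub>R (b - A (2 *\<^sub>R x' - x))))"

fun G_pdhg :: "real \<Rightarrow> real \<Rightarrow> ('x::euclidean_space, 'y::euclidean_space) param
    \<Rightarrow> 'x \<times> 'y \<Rightarrow> 'x \<times> 'y" where
  "G_pdhg \<eta>x \<eta>y (A, b, c) (x, y) =
     (inverse \<eta>x *\<^sub>R x + adjoint A y, A x + inverse \<eta>y *\<^sub>R y)"

end

theory Submission
  imports Defs
begin

text \<open>For a closed convex cone, Moreau's theorem writes every \<open>z\<close> uniquely as \<open>p - d\<close> with \<open>p \<in> K\<close>,
  \<open>d \<in> K\<^sup>*\<close> and \<open>p \<bullet> d = 0\<close>, where \<open>p\<close> and \<open>d\<close> are the projections of \<open>z\<close> and \<open>- z\<close>. These are exactly the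
  cone conditions of the KKT system, so a fixed point of either operator splits into a primal
  feasible \<open>p\<close> and a complementary slack proportional to \<open>d\<close>, and conversely a KKT point assembles
  to a fixed point (\<open>Fix_T_admm_iff\<close>, \<open>Fix_T_pdhg_iff\<close>).

  Averagedness is equivalent to cocoercivity of \<open>Id - T\<close> in the metric \<open>G\<close> (\<open>averaged_wrtI\<close>). In both
  schemes the metric is made so that everything cancels except the inequality
  \<open>(p - p') \<bullet> (d - d') \<le> 0\<close> between the two parts of the Moreau decompositions of two points
  (\<open>moreau_monotone\<close>).

  The ADMM iterates follow \<open>T\<close> because \<open>- z / \<sigma>\<close> is the point projected by the dual step
  (\<open>s_update_z_admm\<close>). The component of \<open>z\<close> in the range of \<open>A\<^sup>*\<close> is then determined by the new
  slack, and its component in the kernel of \<open>A\<close> is moved by the multiplier step, which on the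
  kernel does not see \<open>y\<close> (\<open>z_admm_x_update\<close>).

  The Lipschitz bound in the parameter holds because both operators are composed of sums,
  projections, the data, and linear operators that depend on the parameter in a Lipschitz way on
  bounded sets; for \<open>(A A\<^sup>*)\<^sup>-\<^sup>1\<close> this uses the uniform lower bound \<open>\<kappa>\<close>
  (\<open>linear_lipschitz_on_inv\<close>).\<close>

section \<open>Moreau decomposition for a closed convex cone\<close>

locale closed_convex_cone =
  fixes K :: "'x::euclidean_space set"
  assumes closed: "closed K" and convex_cone: "convex_cone K"
begin

abbreviation proj :: "'x \<Rightarrow> 'x"  where "proj \<equiv> closest_point K"
abbreviation dproj :: "'x \<Rightarrow> 'x" where "dproj z \<equiv> closest_point (dual_cone K) (- z)"

lemma zero_mem: "0 \<in> K" and add_mem: "x \<in> K \<Longrightarrow> y \<in> K \<Longrightarrow> x + y \<in> K"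
  using convex_cone by (auto simp: convex_cone_iff)

lemma convex: "convex K"
  using convex_cone by (simp add: convex_cone_def)

end

lemma dual_cone_Inter: "dual_cone K = (\<Inter>x\<in>K. {s. x \<bullet> s \<ge> 0})"
  by (auto simp: dual_cone_def)

lemma closed_convex_cone_dual: "closed_convex_cone (dual_cone K)"
proof
  show "closed (dual_cone K)"
    unfolding dual_cone_Inter by (intro closed_INT ballI closed_halfspace_ge)
  show "convex_cone (dual_cone K)"
    by (auto simp: convex_cone_iff dual_cone_def inner_add_right)
qed

lemma (in closed_convex_cone) proj_unique:
  assumes p: "p \<in> K" and d: "\<And>x. x \<in> K \<Longrightarrow> 0 \<le> x \<bullet> d" and orth: "p \<bullet> d = 0"
  shows "proj (p - d) = p"
proof -
  have "dist (p - d) p \<le> dist (p - d) x" if "x \<in> K" for x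
  proof -
    have "(norm (p - d - x))\<^sup>2 = (norm d)\<^sup>2 + (norm (p - x))\<^sup>2 + 2 * (x \<bullet> d)"
      using orth by (simp add: power2_norm_eq_inner inner_diff inner_commute algebra_simps)
    with d[OF that] have "(norm d)\<^sup>2 \<le> (norm (p - d - x))\<^sup>2" by simp
    then have "norm d \<le> norm (p - d - x)" by (rule power2_le_imp_le) simp
    then show ?thesis
      by (simp add: dist_norm)
  qed
  then show ?thesis
    using closest_point_unique[OF convex closed p, of "p - d"] by simp
qed

context closed_convex_cone
begin

lemma proj_mem: "proj z \<in> K"
  using closed zero_mem by (intro closest_point_in_set) auto

text \<open>Obtuseness of the angle at the nearest point, tested against translates of the nearest
  point by the cone, puts the residual into the dual cone; tested against the apex, it makes the
  residual orthogonal to the nearest point.\<close>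

lemma residual_dual: "proj z - z \<in> dual_cone K"
proof -
  have "0 \<le> x \<bullet> (proj z - z)" if "x \<in> K" for x
    using closest_point_dot[OF convex closed add_mem[OF proj_mem that], of z z]
    by (simp add: inner_diff_right inner_diff_left inner_commute)
  then show ?thesis by (simp add: dual_cone_def)
qed

lemma residual_orthogonal: "proj z \<bullet> (proj z - z) = 0"
proof (rule antisym)
  show "proj z \<bullet> (proj z - z) \<le> 0"
    using closest_point_dot[OF convex closed zero_mem, of z]
    by (simp add: inner_diff_right inner_diff_left inner_commute)
  show "0 \<le> proj z \<bullet> (proj z - z)"
    using residual_dual[of z] proj_mem[of z] by (simp add: dual_cone_def)
qed

lemma dproj_unique:
  assumes "p \<in> K" "d \<in> dual_cone K" "p \<bullet> d = 0"
  shows "dproj (p - d) = d"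
  using closed_convex_cone.proj_unique[OF closed_convex_cone_dual, of d K p] assms
  by (simp add: dual_cone_def inner_commute)

lemma proj_unique':
  assumes "p \<in> K" "d \<in> dual_cone K" "p \<bullet> d = 0"
  shows "proj (p - d) = p"
  using proj_unique[of p d] assms by (simp add: dual_cone_def)

lemma dproj_eq: "dproj z = proj z - z"
  using dproj_unique[OF proj_mem residual_dual residual_orthogonal, of z] by simp

lemma dproj_mem: "dproj z \<in> dual_cone K" and dproj_orthogonal: "proj z \<bullet> dproj z = 0"
  by (simp_all add: dproj_eq residual_dual residual_orthogonal)

lemma dproj_scaleR:
  assumes "0 \<le> t"
  shows "dproj (t *\<^sub>R z) = t *\<^sub>R dproj z"
proof -
  have "t *\<^sub>R proj z \<in> K" "t *\<^sub>R dproj z \<in> dual_cone K"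
    using assms convex_cone_scaleR[OF convex_cone] proj_mem dproj_mem[of z]
    by (auto simp: dual_cone_def)
  moreover have "t *\<^sub>R proj z - t *\<^sub>R dproj z = t *\<^sub>R z"
    by (simp add: dproj_eq algebra_simps)
  ultimately show ?thesis
    using dproj_unique[of "t *\<^sub>R proj z" "t *\<^sub>R dproj z"] by (simp add: dproj_orthogonal)
qed

text \<open>The two mixed products are nonnegative by duality, the two pure ones vanish by
  orthogonality. This single inequality is the source of averagedness in both schemes.\<close>

lemma moreau_monotone: "(proj z - proj w) \<bullet> (dproj z - dproj w) \<le> 0"
proof -
  have "0 \<le> proj z \<bullet> dproj w" "0 \<le> proj w \<bullet> dproj z"
    using proj_mem dproj_mem by (auto simp: dual_cone_def)
  then show ?thesis
    by (simp add: inner_diff dproj_orthogonal)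
qed

lemma proj_nonexpansive: "norm (proj z - proj w) \<le> norm (z - w)"
  using closest_point_lipschitz[OF convex closed, of z w] zero_mem by (auto simp: dist_norm)

lemma proj_zero: "proj 0 = 0"
  using closest_point_self[OF zero_mem] .

end

section \<open>Self-adjoint operators and averaged maps\<close>

lemma self_adjointI:
  assumes "linear G" "\<And>x y. G x \<bullet> y = x \<bullet> G y"
  shows "self_adjoint G"
  using assms adjoint_unique[of G G] by (simp add: self_adjoint_def)

lemma self_adjoint_inner: "self_adjoint G \<Longrightarrow> G x \<bullet> y = x \<bullet> G y"
  using adjoint_works[of G x y] by (simp add: self_adjoint_def)

lemma loewner_leI:
  assumes S: "self_adjoint S" and T: "self_adjoint T" and le: "\<And>z. z \<bullet> S z \<le> z \<bullet> T z"
  shows "S \<preceq>\<^sub>L T"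
  unfolding loewner_le_def psd_def
proof
  show "self_adjoint (\<lambda>z. T z - S z)"
  proof (rule self_adjointI)
    show "linear (\<lambda>z. T z - S z)"
      using S T by (intro linear_compose_sub) (simp_all add: self_adjoint_def)
    show "(T x - S x) \<bullet> y = x \<bullet> (T y - S y)" for x y
      using self_adjoint_inner[OF S] self_adjoint_inner[OF T] by (simp add: inner_diff)
  qed
  show "\<forall>z. 0 \<le> z \<bullet> (T z - S z)"
    using le by (simp add: inner_diff)
qed

lemma pos_defI:
  assumes "self_adjoint G" "0 < m" "\<And>z. m * (z \<bullet> z) \<le> z \<bullet> G z"
  shows "pos_def G"
  unfolding pos_def_def
proof (intro conjI allI impI assms(1))
  fix z :: 'a
  assume "z \<noteq> 0"
  then have "0 < m * (z \<bullet> z)" using assms(2) by simp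
  then show "0 < z \<bullet> G z" using assms(3)[of z] by linarith
qed

lemma self_adjoint_scaleR_id: "self_adjoint (\<lambda>z. m *\<^sub>R z)"
  by (rule self_adjointI) (simp_all add: linear_iff algebra_simps)

text \<open>With \<open>N = Id - (Id - T) / \<alpha>\<close>, expanding \<open>\<parallel>N z - N w\<parallel>\<^sup>2 \<le> \<parallel>z - w\<parallel>\<^sup>2\<close>
  in the weighted inner product shows it to be cocoercivity of \<open>F = Id - T\<close> with constant \<open>1 / (2 \<alpha>)\<close>.\<close>

lemma averaged_wrtI:
  assumes G: "self_adjoint G" and \<alpha>: "0 < \<alpha>"
    and coco: "\<And>z w. let F = (z - T z) - (w - T w) in F \<bullet> G F \<le> 2 * \<alpha> * ((z - w) \<bullet> G F)"
  shows "averaged_wrt G \<alpha> T"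
  unfolding averaged_wrt_def
proof (intro exI conjI allI)
  define N where "N z = z - inverse \<alpha> *\<^sub>R (z - T z)" for z
  show "T z = (1 - \<alpha>) *\<^sub>R z + \<alpha> *\<^sub>R N z" for z
    using \<alpha> by (simp add: N_def algebra_simps)
  have lin: "linear G" using G by (simp add: self_adjoint_def)
  show "nonexpansive_wrt G N"
    unfolding nonexpansive_wrt_def
  proof (intro allI)
    fix z w
    define F where "F = (z - T z) - (w - T w)"
    have "N z - N w = (z - w) - inverse \<alpha> *\<^sub>R F"
      by (simp add: N_def F_def algebra_simps)
    moreover have "(v - t *\<^sub>R F) \<bullet> G (v - t *\<^sub>R F)
        = v \<bullet> G v - t * (2 * (v \<bullet> G F) - t * (F \<bullet> G F))" for v t
      using self_adjoint_inner[OF G, of F v] inner_commute[of "G F" v]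
      by (simp add: linear_diff[OF lin] linear_scale[OF lin] inner_diff algebra_simps)
    moreover have "inverse \<alpha> * (F \<bullet> G F) \<le> 2 * ((z - w) \<bullet> G F)"
      using coco[of z w] \<alpha> by (simp add: F_def Let_def field_simps)
    ultimately have "(N z - N w) \<bullet> G (N z - N w) \<le> (z - w) \<bullet> G (z - w)"
      using \<alpha> by simp
    then show "weighted_norm G (N z - N w) \<le> weighted_norm G (z - w)"
      by (simp add: weighted_norm_def)
  qed
qed

section \<open>Linear maps with coercive Gram operator\<close>

lemma linear_blinfun: "linear (blinfun_apply A)"
  by (simp add: linear_iff blinfun.add_right blinfun.scaleR_right)

lemma adjoint_inner:
  fixes A :: "'x::euclidean_space \<Rightarrow>\<^sub>L 'y::euclidean_space"
  shows "adjoint A v \<bullet> u = v \<bullet> A u" and "u \<bullet> adjoint A v = A u \<bullet> v"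
  by (rule adjoint_clauses[OF linear_blinfun])+

lemma linear_adjoint: "linear (adjoint (blinfun_apply (A :: 'x::euclidean_space \<Rightarrow>\<^sub>L 'y::euclidean_space)))"
  by (rule adjoint_linear[OF linear_blinfun])

lemma linear_gram: "linear (gram A)"
  unfolding gram_def using linear_compose[OF linear_adjoint linear_blinfun] by (simp add: o_def)

lemma coercive_inverse:
  fixes L :: "'y::euclidean_space \<Rightarrow> 'y"
  assumes lin: "linear L" and \<kappa>: "0 < \<kappa>" and coer: "\<And>v. \<kappa> * (v \<bullet> v) \<le> v \<bullet> L v"
  shows "bij L" and "linear (inv L)" and "norm (inv L v) \<le> inverse \<kappa> * norm v"
proof -
  have bound: "\<kappa> * norm v \<le> norm (L v)" for v
  proof (cases "v = 0")
    case False
    have "\<kappa> * norm v * norm v \<le> norm (L v) * norm v"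
      using coer[of v] Cauchy_Schwarz_ineq2[of v "L v"]
      by (simp add: power2_norm_eq_inner[symmetric] power2_eq_square algebra_simps)
    with False show ?thesis by simp
  qed simp
  have "v = 0" if "L v = 0" for v
    using bound[of v] \<kappa> that by (simp add: mult_le_0_iff)
  then have inj: "inj L"
    using linear_injective_0[OF lin] by blast
  then show bij: "bij L"
    using linear_injective_imp_surjective[OF lin] by (simp add: bij_def)
  then show "linear (inv L)"
    using lin inj_linear_imp_inv_linear inj by blast
  show "norm (inv L v) \<le> inverse \<kappa> * norm v"
    using bound[of "inv L v"] bij \<kappa> by (simp add: bij_is_surj surj_f_inv_f field_simps)
qed

locale coercive_gram =
  fixes A :: "'x::euclidean_space \<Rightarrow>\<^sub>L 'y::euclidean_space" and \<kappa> :: real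
  assumes \<kappa>: "0 < \<kappa>" and coercive: "(\<lambda>y. \<kappa> *\<^sub>R y) \<preceq>\<^sub>L gram A"
begin

lemma coercive_inner: "\<kappa> * (v \<bullet> v) \<le> v \<bullet> gram A v"
  using coercive by (simp add: loewner_le_def psd_def inner_diff)

lemmas gram_facts = coercive_inverse[OF linear_gram \<kappa> coercive_inner, folded gram_inv_def]

lemma gram_gram_inv: "gram A (gram_inv A v) = v"
  using gram_facts(1) by (simp add: gram_inv_def bij_is_surj surj_f_inv_f)

lemma gram_inv_gram: "gram_inv A (gram A v) = v"
  using gram_facts(1) by (simp add: gram_inv_def bij_is_inj)

lemma gram_inv_inner: "gram_inv A u \<bullet> v = u \<bullet> gram_inv A v"
proof -
  have "gram A p \<bullet> q = p \<bullet> gram A q" for p q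
    by (metis adjoint_inner gram_def)
  from this[of "gram_inv A u" "gram_inv A v"] show ?thesis
    by (simp add: gram_gram_inv)
qed

lemma apply_op_pinv: "A (op_pinv A b) = b"
  using gram_gram_inv by (simp add: op_pinv_def gram_def)

lemma P_ran_adjoint: "P_ran A (adjoint A y) = adjoint A y"
  using gram_inv_gram by (simp add: P_ran_def op_pinv_def gram_def)

lemma P_ran_op_pinv: "P_ran A (op_pinv A b) = op_pinv A b"
  by (simp add: P_ran_def apply_op_pinv)

lemma P_ran_idem: "P_ran A (P_ran A x) = P_ran A x"
  by (simp add: P_ran_def apply_op_pinv)

lemma apply_P_ran: "A (P_ran A x) = A x"
  by (simp add: P_ran_def apply_op_pinv)

lemma linear_op_pinv: "linear (op_pinv A)"
  using linear_compose[OF gram_facts(2) linear_adjoint[of A]] by (simp add: op_pinv_def[abs_def] o_def)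

lemma linear_P_ran: "linear (P_ran A)"
  using linear_compose[OF linear_blinfun linear_op_pinv] by (simp add: P_ran_def[abs_def] o_def)

lemma linear_P_perp: "linear (P_perp A)"
  unfolding P_perp_def by (intro linear_compose_sub linear_ident linear_P_ran)

lemmas P_linear =
  linear_add[OF linear_P_ran] linear_diff[OF linear_P_ran] linear_scale[OF linear_P_ran]
  linear_0[OF linear_P_ran] linear_neg[OF linear_P_ran]
  linear_add[OF linear_P_perp] linear_diff[OF linear_P_perp] linear_scale[OF linear_P_perp]
  linear_0[OF linear_P_perp] linear_neg[OF linear_P_perp]

lemmas pinv_linear =
  linear_add[OF linear_op_pinv] linear_diff[OF linear_op_pinv] linear_scale[OF linear_op_pinv]

lemma P_ran_inner: "P_ran A u \<bullet> v = u \<bullet> P_ran A v"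
  by (simp add: P_ran_def op_pinv_def adjoint_inner gram_inv_inner)

lemma P_ran_inner_same: "u \<bullet> P_ran A v = P_ran A u \<bullet> P_ran A v"
  by (simp add: P_ran_inner P_ran_idem)

lemma P_perp_inner_same: "u \<bullet> P_perp A v = P_perp A u \<bullet> P_perp A v"
  using P_ran_inner_same[of u v] by (simp add: P_perp_def inner_diff P_ran_inner)

lemma P_ran_P_perp: "P_ran A (P_perp A u) = 0" "P_perp A (P_ran A u) = 0"
  by (simp_all add: P_perp_def P_linear P_ran_idem)

lemma P_perp_idem: "P_perp A (P_perp A u) = P_perp A u"
  using P_ran_P_perp(1)[of u] by (simp add: P_perp_def[of A "P_perp A u"])

lemma P_perp_adjoint: "P_perp A (adjoint A y) = 0"
  by (simp add: P_perp_def P_ran_adjoint)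

lemma P_decomp: "P_ran A u + P_perp A u = u"
  by (simp add: P_perp_def)

lemma inner_decomp: "u \<bullet> v = P_ran A u \<bullet> P_ran A v + P_perp A u \<bullet> P_perp A v"
  using P_ran_inner_same[of u v] P_perp_inner_same[of u v]
  by (simp add: inner_add_right[of u "P_ran A v" "P_perp A v", unfolded P_decomp])

end

section \<open>Families that depend on the parameter in a Lipschitz way\<close>

text \<open>The Lipschitz bound with affine growth is closed under sums, nonexpansive maps fixing the
  origin and Lipschitz families of linear operators. Both fixed-point operators are built from
  the data by these operations alone, so their Lipschitz bounds follow by composition.\<close>

definition affine_lipschitz_on ::
    "'p::real_normed_vector set \<Rightarrow> ('p \<Rightarrow> 'a::real_normed_vector \<Rightarrow> 'b::real_normed_vector) \<Rightarrow> bool" where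
  "affine_lipschitz_on U f \<longleftrightarrow> (\<exists>C\<ge>0. \<forall>\<theta>\<in>U. \<forall>z. norm (f \<theta> z) \<le> C * (1 + norm z) \<and>
     (\<forall>\<theta>'\<in>U. norm (f \<theta> z - f \<theta>' z) \<le> C * (1 + norm z) * norm (\<theta> - \<theta>')))"

definition linear_lipschitz_on ::
    "'p::real_normed_vector set \<Rightarrow> ('p \<Rightarrow> 'a::real_normed_vector \<Rightarrow> 'b::real_normed_vector) \<Rightarrow> bool" where
  "linear_lipschitz_on U L \<longleftrightarrow> affine_lipschitz_on U L \<and> (\<forall>\<theta>\<in>U. linear (L \<theta>))"

lemma affine_lipschitz_onI:
  assumes "0 \<le> C" "\<And>\<theta> z. \<theta> \<in> U \<Longrightarrow> norm (f \<theta> z) \<le> C * (1 + norm z)"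
    "\<And>\<theta> \<theta>' z. \<theta> \<in> U \<Longrightarrow> \<theta>' \<in> U \<Longrightarrow> norm (f \<theta> z - f \<theta>' z) \<le> C * (1 + norm z) * norm (\<theta> - \<theta>')"
  shows "affine_lipschitz_on U f"
  unfolding affine_lipschitz_on_def using assms by blast

lemma affine_lipschitz_onE:
  assumes "affine_lipschitz_on U f"
  obtains C where "0 \<le> C" "\<And>\<theta> z. \<theta> \<in> U \<Longrightarrow> norm (f \<theta> z) \<le> C * (1 + norm z)"
    "\<And>\<theta> \<theta>' z. \<theta> \<in> U \<Longrightarrow> \<theta>' \<in> U \<Longrightarrow> norm (f \<theta> z - f \<theta>' z) \<le> C * (1 + norm z) * norm (\<theta> - \<theta>')"
  using assms unfolding affine_lipschitz_on_def by blast

lemma linear_lipschitz_onI: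
  fixes L :: "'p::real_normed_vector \<Rightarrow> 'a::real_normed_vector \<Rightarrow> 'b::real_normed_vector"
  assumes C: "0 \<le> C" and lin: "\<And>\<theta>. \<theta> \<in> U \<Longrightarrow> linear (L \<theta>)"
    and bound: "\<And>\<theta> v. \<theta> \<in> U \<Longrightarrow> norm (L \<theta> v) \<le> C * norm v"
    and lip: "\<And>\<theta> \<theta>' v. \<theta> \<in> U \<Longrightarrow> \<theta>' \<in> U \<Longrightarrow> norm (L \<theta> v - L \<theta>' v) \<le> C * norm v * norm (\<theta> - \<theta>')"
  shows "linear_lipschitz_on U L"
proof -
  have le: "C * norm v \<le> C * (1 + norm v)" for v :: 'a
    using C by (intro mult_left_mono) auto
  have "affine_lipschitz_on U L"
  proof (rule affine_lipschitz_onI[OF C])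
    show "norm (L \<theta> v) \<le> C * (1 + norm v)" if "\<theta> \<in> U" for \<theta> v
      by (rule order_trans[OF bound[OF that] le])
    show "norm (L \<theta> v - L \<theta>' v) \<le> C * (1 + norm v) * norm (\<theta> - \<theta>')"
      if "\<theta> \<in> U" "\<theta>' \<in> U" for \<theta> \<theta>' v
      by (rule order_trans[OF lip[OF that] mult_right_mono[OF le]]) simp
  qed
  with lin show ?thesis by (simp add: linear_lipschitz_on_def)
qed

lemma linear_affine_growth:
  assumes "linear g" "\<And>z. norm (g z) \<le> c * (1 + norm z)"
  shows "norm (g v) \<le> 2 * c * norm v"
proof (cases "v = 0")
  case False
  have "norm (g (inverse (norm v) *\<^sub>R v)) \<le> 2 * c"
    using assms(2)[of "inverse (norm v) *\<^sub>R v"] False by simp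
  with False show ?thesis
    by (simp add: linear_scale[OF assms(1)] field_simps)
qed (simp add: linear_0[OF assms(1)])

text \<open>For linear operators homogeneity removes the additive constant from the affine growth.\<close>

lemma linear_lipschitz_onE:
  assumes "linear_lipschitz_on U L"
  obtains C where "0 \<le> C" "\<And>\<theta>. \<theta> \<in> U \<Longrightarrow> linear (L \<theta>)" "\<And>\<theta> v. \<theta> \<in> U \<Longrightarrow> norm (L \<theta> v) \<le> C * norm v"
    "\<And>\<theta> \<theta>' v. \<theta> \<in> U \<Longrightarrow> \<theta>' \<in> U \<Longrightarrow> norm (L \<theta> v - L \<theta>' v) \<le> C * norm v * norm (\<theta> - \<theta>')"
proof -
  have lin: "\<And>\<theta>. \<theta> \<in> U \<Longrightarrow> linear (L \<theta>)" and "affine_lipschitz_on U L"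
    using assms by (auto simp: linear_lipschitz_on_def)
  then obtain C where C: "0 \<le> C" "\<And>\<theta> z. \<theta> \<in> U \<Longrightarrow> norm (L \<theta> z) \<le> C * (1 + norm z)"
    "\<And>\<theta> \<theta>' z. \<theta> \<in> U \<Longrightarrow> \<theta>' \<in> U \<Longrightarrow> norm (L \<theta> z - L \<theta>' z) \<le> C * (1 + norm z) * norm (\<theta> - \<theta>')"
    by (auto elim!: affine_lipschitz_onE)
  show thesis
  proof (rule that[of "2 * C"])
    show "norm (L \<theta> v) \<le> 2 * C * norm v" if "\<theta> \<in> U" for \<theta> v
      by (rule linear_affine_growth[OF lin[OF that] C(2)[OF that]])
    show "norm (L \<theta> v - L \<theta>' v) \<le> 2 * C * norm v * norm (\<theta> - \<theta>')" if "\<theta> \<in> U" "\<theta>' \<in> U" for \<theta> \<theta>' v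
      using linear_affine_growth[OF linear_compose_sub[OF lin lin, OF that], of "C * norm (\<theta> - \<theta>')" v]
        C(3)[OF that] by (simp add: ac_simps)
  qed (use C(1) lin in auto)
qed

lemma affine_lipschitz_on_add:
  assumes "affine_lipschitz_on U f" "affine_lipschitz_on U g"
  shows "affine_lipschitz_on U (\<lambda>\<theta> z. f \<theta> z + g \<theta> z)"
proof -
  obtain C where C: "0 \<le> C" "\<And>\<theta> z. \<theta> \<in> U \<Longrightarrow> norm (f \<theta> z) \<le> C * (1 + norm z)"
    "\<And>\<theta> \<theta>' z. \<theta> \<in> U \<Longrightarrow> \<theta>' \<in> U \<Longrightarrow> norm (f \<theta> z - f \<theta>' z) \<le> C * (1 + norm z) * norm (\<theta> - \<theta>')"
    by (rule affine_lipschitz_onE[OF assms(1)]) blast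
  obtain D where D: "0 \<le> D" "\<And>\<theta> z. \<theta> \<in> U \<Longrightarrow> norm (g \<theta> z) \<le> D * (1 + norm z)"
    "\<And>\<theta> \<theta>' z. \<theta> \<in> U \<Longrightarrow> \<theta>' \<in> U \<Longrightarrow> norm (g \<theta> z - g \<theta>' z) \<le> D * (1 + norm z) * norm (\<theta> - \<theta>')"
    by (rule affine_lipschitz_onE[OF assms(2)]) blast
  show ?thesis
  proof (rule affine_lipschitz_onI)
    show "0 \<le> C + D" using C(1) D(1) by simp
    show "norm (f \<theta> z + g \<theta> z) \<le> (C + D) * (1 + norm z)" if "\<theta> \<in> U" for \<theta> z
      using norm_triangle_mono[OF C(2)[OF that, of z] D(2)[OF that, of z]]
      by (simp add: distrib_right)
    show "norm (f \<theta> z + g \<theta> z - (f \<theta>' z + g \<theta>' z)) \<le> (C + D) * (1 + norm z) * norm (\<theta> - \<theta>')"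
      if "\<theta> \<in> U" "\<theta>' \<in> U" for \<theta> \<theta>' z
      using norm_triangle_mono[OF C(3)[OF that, of z] D(3)[OF that, of z]]
      by (simp add: add_diff_add distrib_right)
  qed
qed

text \<open>Stated with an arbitrary factor so that multiplication by scalars and pairing of
  components are instances.\<close>

lemma affine_lipschitz_on_comp:
  assumes f: "affine_lipschitz_on U f" and r: "0 \<le> r"
    and g: "\<And>v w. norm (g v - g w) \<le> r * norm (v - w)" "g 0 = 0"
  shows "affine_lipschitz_on U (\<lambda>\<theta> z. g (f \<theta> z))"
proof -
  obtain C where C: "0 \<le> C" "\<And>\<theta> z. \<theta> \<in> U \<Longrightarrow> norm (f \<theta> z) \<le> C * (1 + norm z)"
    "\<And>\<theta> \<theta>' z. \<theta> \<in> U \<Longrightarrow> \<theta>' \<in> U \<Longrightarrow> norm (f \<theta> z - f \<theta>' z) \<le> C * (1 + norm z) * norm (\<theta> - \<theta>')"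
    by (rule affine_lipschitz_onE[OF f]) blast
  have g0: "norm (g v) \<le> r * norm v" for v
    using g(1)[of v 0] g(2) by simp
  show ?thesis
  proof (rule affine_lipschitz_onI)
    show "0 \<le> r * C" using C(1) r by simp
    show "norm (g (f \<theta> z)) \<le> r * C * (1 + norm z)" if "\<theta> \<in> U" for \<theta> z
      using order_trans[OF g0 mult_left_mono[OF C(2)[OF that] r]] by (simp add: mult.assoc)
    show "norm (g (f \<theta> z) - g (f \<theta>' z)) \<le> r * C * (1 + norm z) * norm (\<theta> - \<theta>')"
      if "\<theta> \<in> U" "\<theta>' \<in> U" for \<theta> \<theta>' z
      using order_trans[OF g(1) mult_left_mono[OF C(3)[OF that] r]] by (simp add: mult.assoc)
  qed
qed

lemma affine_lipschitz_on_scaleR: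
  "affine_lipschitz_on U f \<Longrightarrow> affine_lipschitz_on U (\<lambda>\<theta> z. r *\<^sub>R f \<theta> z)"
  by (erule affine_lipschitz_on_comp[where r = "\<bar>r\<bar>"]) (simp_all flip: scaleR_diff_right)

lemma affine_lipschitz_on_minus:
  "affine_lipschitz_on U f \<Longrightarrow> affine_lipschitz_on U (\<lambda>\<theta> z. - f \<theta> z)"
  using affine_lipschitz_on_scaleR[of U f "-1"] by simp

lemma affine_lipschitz_on_diff:
  "affine_lipschitz_on U f \<Longrightarrow> affine_lipschitz_on U g \<Longrightarrow> affine_lipschitz_on U (\<lambda>\<theta> z. f \<theta> z - g \<theta> z)"
  using affine_lipschitz_on_add[OF _ affine_lipschitz_on_minus, of U f g] by simp

lemma affine_lipschitz_on_Pair: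
  assumes "affine_lipschitz_on U f" "affine_lipschitz_on U g"
  shows "affine_lipschitz_on U (\<lambda>\<theta> z. (f \<theta> z, g \<theta> z))"
proof -
  have "affine_lipschitz_on U (\<lambda>\<theta> z. (f \<theta> z, 0))" "affine_lipschitz_on U (\<lambda>\<theta> z. (0, g \<theta> z))"
    using affine_lipschitz_on_comp[OF assms(1), of 1 "\<lambda>v. (v, 0)"]
      affine_lipschitz_on_comp[OF assms(2), of 1 "\<lambda>v. (0, v)"]
    by (simp_all add: norm_Pair zero_prod_def)
  from affine_lipschitz_on_add[OF this] show ?thesis by simp
qed

lemma affine_lipschitz_on_id: "affine_lipschitz_on U (\<lambda>\<theta> z. z)"
  by (rule affine_lipschitz_onI[where C = 1]) auto

lemma norm_fst_snd_le: "norm (fst z) \<le> norm z" "norm (snd z) \<le> norm z"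
  by (metis norm_fst_le prod.collapse, metis norm_snd_le prod.collapse)

lemma affine_lipschitz_on_fst: "affine_lipschitz_on U (\<lambda>\<theta> z. fst z)"
  by (rule affine_lipschitz_on_comp[OF affine_lipschitz_on_id, where r = 1])
    (simp_all add: norm_fst_snd_le flip: fst_diff)

lemma affine_lipschitz_on_snd: "affine_lipschitz_on U (\<lambda>\<theta> z. snd z)"
  by (rule affine_lipschitz_on_comp[OF affine_lipschitz_on_id, where r = 1])
    (simp_all add: norm_fst_snd_le flip: snd_diff)

lemma affine_lipschitz_on_param:
  assumes "bounded U" and p: "\<And>\<theta>. norm (p \<theta>) \<le> norm \<theta>" and "\<And>\<theta> \<theta>'. p \<theta> - p \<theta>' = p (\<theta> - \<theta>')"
  shows "affine_lipschitz_on U (\<lambda>\<theta> z. p \<theta>)"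
proof -
  obtain R where R: "0 < R" "\<And>\<theta>. \<theta> \<in> U \<Longrightarrow> norm \<theta> \<le> R"
    using assms(1) by (auto simp: bounded_pos)
  show ?thesis
  proof (rule affine_lipschitz_onI)
    show "0 \<le> R + 1" using R by simp
    show "norm (p \<theta>) \<le> (R + 1) * (1 + norm z)" if "\<theta> \<in> U" for \<theta> z
    proof -
      have "norm (p \<theta>) \<le> R * 1" using p[of \<theta>] R(2)[OF that] by simp
      also have "\<dots> \<le> (R + 1) * (1 + norm z)" using R(1) by (intro mult_mono) auto
      finally show ?thesis .
    qed
    show "norm (p \<theta> - p \<theta>') \<le> (R + 1) * (1 + norm z) * norm (\<theta> - \<theta>')" for \<theta> \<theta>' z
    proof -
      have "1 * 1 \<le> (R + 1) * (1 + norm z)" using R(1) by (intro mult_mono) auto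
      then have "1 * norm (\<theta> - \<theta>') \<le> (R + 1) * (1 + norm z) * norm (\<theta> - \<theta>')"
        by (intro mult_right_mono) auto
      with p[of "\<theta> - \<theta>'"] show ?thesis by (simp add: assms(3))
    qed
  qed
qed

lemma affine_lipschitz_on_data:
  fixes U :: "('x::euclidean_space, 'y::euclidean_space) param set"
  assumes "bounded U"
  shows "affine_lipschitz_on U (\<lambda>\<theta> z. fst (snd \<theta>))" and "affine_lipschitz_on U (\<lambda>\<theta> z. snd (snd \<theta>))"
proof -
  have "norm (fst (snd \<theta>)) \<le> norm \<theta>" "norm (snd (snd \<theta>)) \<le> norm \<theta>" for \<theta> :: "('x, 'y) param"
    by (meson norm_fst_snd_le order_trans)+
  then show "affine_lipschitz_on U (\<lambda>\<theta> z. fst (snd \<theta>))" "affine_lipschitz_on U (\<lambda>\<theta> z. snd (snd \<theta>))"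
    using assms by (auto intro!: affine_lipschitz_on_param)
qed

lemma affine_lipschitz_on_linear:
  fixes L :: "'p::real_normed_vector \<Rightarrow> 'a::real_normed_vector \<Rightarrow> 'b::real_normed_vector"
    and f :: "'p \<Rightarrow> 'c::real_normed_vector \<Rightarrow> 'a"
  assumes "linear_lipschitz_on U L" "affine_lipschitz_on U f"
  shows "affine_lipschitz_on U (\<lambda>\<theta> z. L \<theta> (f \<theta> z))"
proof -
  obtain C where C: "0 \<le> C" "\<And>\<theta>. \<theta> \<in> U \<Longrightarrow> linear (L \<theta>)" "\<And>\<theta> v. \<theta> \<in> U \<Longrightarrow> norm (L \<theta> v) \<le> C * norm v"
    "\<And>\<theta> \<theta>' v. \<theta> \<in> U \<Longrightarrow> \<theta>' \<in> U \<Longrightarrow> norm (L \<theta> v - L \<theta>' v) \<le> C * norm v * norm (\<theta> - \<theta>')"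
    by (rule linear_lipschitz_onE[OF assms(1)]) blast
  obtain D where D: "0 \<le> D" "\<And>\<theta> z. \<theta> \<in> U \<Longrightarrow> norm (f \<theta> z) \<le> D * (1 + norm z)"
    "\<And>\<theta> \<theta>' z. \<theta> \<in> U \<Longrightarrow> \<theta>' \<in> U \<Longrightarrow> norm (f \<theta> z - f \<theta>' z) \<le> D * (1 + norm z) * norm (\<theta> - \<theta>')"
    by (rule affine_lipschitz_onE[OF assms(2)]) blast
  show ?thesis
  proof (rule affine_lipschitz_onI)
    show "0 \<le> 2 * C * D" using C(1) D(1) by simp
    have CD: "C * norm (f \<theta> z) \<le> C * D * (1 + norm z)" if "\<theta> \<in> U" for \<theta> z
      using mult_left_mono[OF D(2)[OF that] C(1)] by (simp add: mult.assoc)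
    have pos: "0 \<le> C * D * (1 + norm z)" for z :: 'c using C(1) D(1) by simp
    show "norm (L \<theta> (f \<theta> z)) \<le> 2 * C * D * (1 + norm z)" if "\<theta> \<in> U" for \<theta> z
      using C(3)[OF that, of "f \<theta> z"] CD[OF that, of z] pos[of z] by simp
    show "norm (L \<theta> (f \<theta> z) - L \<theta>' (f \<theta>' z)) \<le> 2 * C * D * (1 + norm z) * norm (\<theta> - \<theta>')"
      if \<theta>: "\<theta> \<in> U" "\<theta>' \<in> U" for \<theta> \<theta>' z
    proof -
      have "L \<theta> (f \<theta> z) - L \<theta>' (f \<theta>' z) = L \<theta> (f \<theta> z - f \<theta>' z) + (L \<theta> (f \<theta>' z) - L \<theta>' (f \<theta>' z))"
        by (simp add: linear_diff[OF C(2)[OF \<theta>(1)]])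
      moreover have "norm (L \<theta> (f \<theta> z - f \<theta>' z)) \<le> C * (D * (1 + norm z) * norm (\<theta> - \<theta>'))"
        by (rule order_trans[OF C(3)[OF \<theta>(1)] mult_left_mono[OF D(3)[OF \<theta>] C(1)]])
      moreover have "norm (L \<theta> (f \<theta>' z) - L \<theta>' (f \<theta>' z)) \<le> C * D * (1 + norm z) * norm (\<theta> - \<theta>')"
        by (rule order_trans[OF C(4)[OF \<theta>] mult_right_mono[OF CD[OF \<theta>(2)]]]) simp
      ultimately show ?thesis
        using norm_triangle_mono by (fastforce simp: algebra_simps)
    qed
  qed
qed

lemma linear_lipschitz_on_compose:
  assumes L: "linear_lipschitz_on U L" and M: "linear_lipschitz_on U M"
  shows "linear_lipschitz_on U (\<lambda>\<theta> v. L \<theta> (M \<theta> v))"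
proof -
  have "linear (\<lambda>v. L \<theta> (M \<theta> v))" if "\<theta> \<in> U" for \<theta>
    using L M that linear_compose[of "M \<theta>" "L \<theta>"] by (simp add: linear_lipschitz_on_def o_def)
  moreover have "affine_lipschitz_on U M"
    using M by (simp add: linear_lipschitz_on_def)
  ultimately show ?thesis
    using affine_lipschitz_on_linear[OF L] by (simp add: linear_lipschitz_on_def)
qed

text \<open>The resolvent identity \<open>L\<^sup>-\<^sup>1 - M\<^sup>-\<^sup>1 = L\<^sup>-\<^sup>1 (M - L) M\<^sup>-\<^sup>1\<close>, with inverses bounded uniformly by
  \<open>1 / \<kappa>\<close>.\<close>

lemma linear_lipschitz_on_inv:
  fixes L :: "'p::real_normed_vector \<Rightarrow> 'y::euclidean_space \<Rightarrow> 'y"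
  assumes L: "linear_lipschitz_on U L" and \<kappa>: "0 < \<kappa>"
    and coer: "\<And>\<theta> v. \<theta> \<in> U \<Longrightarrow> \<kappa> * (v \<bullet> v) \<le> v \<bullet> L \<theta> v"
  shows "linear_lipschitz_on U (\<lambda>\<theta>. inv (L \<theta>))"
proof -
  obtain C where C: "0 \<le> C" "\<And>\<theta>. \<theta> \<in> U \<Longrightarrow> linear (L \<theta>)" "\<And>\<theta> v. \<theta> \<in> U \<Longrightarrow> norm (L \<theta> v) \<le> C * norm v"
    "\<And>\<theta> \<theta>' v. \<theta> \<in> U \<Longrightarrow> \<theta>' \<in> U \<Longrightarrow> norm (L \<theta> v - L \<theta>' v) \<le> C * norm v * norm (\<theta> - \<theta>')"
    by (rule linear_lipschitz_onE[OF L]) blast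
  note inv = coercive_inverse[OF C(2) \<kappa> coer]
  define i where "i = inverse \<kappa>"
  have i: "0 \<le> i" using \<kappa> by (simp add: i_def)
  have inv_le: "norm (inv (L \<theta>) v) \<le> i * norm v" if "\<theta> \<in> U" for \<theta> v
    using inv(3)[OF that that] by (simp add: i_def)
  show ?thesis
  proof (rule linear_lipschitz_onI)
    show "0 \<le> i + i * C * i" using i C(1) by simp
    show "linear (inv (L \<theta>))" if "\<theta> \<in> U" for \<theta> using inv(2) that by blast
    show "norm (inv (L \<theta>) v) \<le> (i + i * C * i) * norm v" if "\<theta> \<in> U" for \<theta> v
    proof -
      have "0 \<le> i * C * i * norm v" using i C(1) by simp
      with inv_le[OF that, of v] show ?thesis by (simp add: distrib_right)
    qed
    show "norm (inv (L \<theta>) v - inv (L \<theta>') v) \<le> (i + i * C * i) * norm v * norm (\<theta> - \<theta>')"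
      if \<theta>: "\<theta> \<in> U" "\<theta>' \<in> U" for \<theta> \<theta>' v
    proof -
      define w where "w = inv (L \<theta>') v"
      have bij: "bij (L \<theta>)" "bij (L \<theta>')" using inv(1) \<theta> by blast+
      have w: "L \<theta>' w = v" "norm w \<le> i * norm v"
        using bij inv_le[OF \<theta>(2)] by (simp_all add: w_def bij_is_surj surj_f_inv_f)
      have "inv (L \<theta>) v - w = inv (L \<theta>) (L \<theta>' w - L \<theta> w)"
        using inv(2)[OF \<theta>(1) \<theta>(1)] bij by (simp add: linear_diff w bij_is_inj)
      then have "norm (inv (L \<theta>) v - w) \<le> i * norm (L \<theta>' w - L \<theta> w)"
        using inv_le[OF \<theta>(1)] by simp
      also have "\<dots> \<le> i * (C * norm w * norm (\<theta> - \<theta>'))"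
        using C(4)[OF \<theta>, of w] i by (intro mult_left_mono) (simp_all add: norm_minus_commute)
      also have "\<dots> \<le> i * (C * (i * norm v) * norm (\<theta> - \<theta>'))"
        using i C(1) w by (intro mult_left_mono mult_right_mono) auto
      also have "\<dots> \<le> (i + i * C * i) * norm v * norm (\<theta> - \<theta>')"
        using i by (simp add: algebra_simps)
      finally show ?thesis by (simp add: w_def)
    qed
  qed
qed

lemma linear_lipschitz_on_blinfun:
  fixes U :: "('x::euclidean_space, 'y::euclidean_space) param set"
  assumes "bounded U"
  shows "linear_lipschitz_on U (\<lambda>\<theta>. blinfun_apply (fst \<theta>))"
    and "linear_lipschitz_on U (\<lambda>\<theta>. adjoint (blinfun_apply (fst \<theta>)))"
proof -
  obtain R where R: "0 < R" "\<And>\<theta>. \<theta> \<in> U \<Longrightarrow> norm \<theta> \<le> R"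
    using assms by (auto simp: bounded_pos)
  have adj: "norm (adjoint A v) \<le> norm A * norm v" for A :: "'x \<Rightarrow>\<^sub>L 'y" and v
  proof (cases "adjoint A v = 0")
    case False
    have "norm (adjoint A v) * norm (adjoint A v) = v \<bullet> A (adjoint A v)"
      using power2_norm_eq_inner[of "adjoint A v"] adjoint_inner(1)[of A v "adjoint A v"]
      by (simp add: power2_eq_square)
    also have "\<dots> \<le> norm v * norm (A (adjoint A v))"
      by (rule norm_cauchy_schwarz)
    also have "\<dots> \<le> norm v * (norm A * norm (adjoint A v))"
      by (intro mult_left_mono norm_blinfun) simp
    finally show ?thesis using False by (simp add: algebra_simps)
  qed simp
  have adj_diff: "adjoint A v - adjoint B v = adjoint (A - B) v" for A B :: "'x \<Rightarrow>\<^sub>L 'y" and v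
  proof -
    have "(adjoint A v - adjoint B v) \<bullet> u = adjoint (A - B) v \<bullet> u" for u
      by (simp add: inner_diff adjoint_inner blinfun.diff_left)
    then show ?thesis using vector_eq_rdot by blast
  qed
  have bound: "norm (fst \<theta>) * norm v \<le> (R + 1) * norm v" if "\<theta> \<in> U" for \<theta> and v :: "'v::real_normed_vector"
    using norm_fst_snd_le(1)[of \<theta>] R(2)[OF that] by (intro mult_right_mono) auto
  have lip: "norm (fst \<theta> - fst \<theta>') * norm v \<le> (R + 1) * norm v * norm (\<theta> - \<theta>')"
    for \<theta> \<theta>' :: "('x, 'y) param" and v :: "'v::real_normed_vector"
  proof -
    have "norm (fst \<theta> - fst \<theta>') * norm v \<le> norm (\<theta> - \<theta>') * norm v"
      using norm_fst_snd_le(1)[of "\<theta> - \<theta>'"] by (intro mult_right_mono) auto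
    also have "\<dots> \<le> (R + 1) * (norm (\<theta> - \<theta>') * norm v)"
      using R(1) mult_right_mono[of 1 "R + 1" "norm (\<theta> - \<theta>') * norm v"] by simp
    finally show ?thesis by (simp add: algebra_simps)
  qed
  show "linear_lipschitz_on U (\<lambda>\<theta>. blinfun_apply (fst \<theta>))"
  proof (rule linear_lipschitz_onI)
    show "0 \<le> R + 1" using R by simp
    show "norm (blinfun_apply (fst \<theta>) v) \<le> (R + 1) * norm v" if "\<theta> \<in> U" for \<theta> v
      by (rule order_trans[OF norm_blinfun bound[OF that]])
    show "norm (blinfun_apply (fst \<theta>) v - blinfun_apply (fst \<theta>') v) \<le> (R + 1) * norm v * norm (\<theta> - \<theta>')" for \<theta> \<theta>' :: "('x, 'y) param" and v
      unfolding blinfun.diff_left[symmetric] by (rule order_trans[OF norm_blinfun lip])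
  qed (rule linear_blinfun)
  show "linear_lipschitz_on U (\<lambda>\<theta>. adjoint (blinfun_apply (fst \<theta>)))"
  proof (rule linear_lipschitz_onI)
    show "0 \<le> R + 1" using R by simp
    show "norm (adjoint (blinfun_apply (fst \<theta>)) v) \<le> (R + 1) * norm v" if "\<theta> \<in> U" for \<theta> v
      by (rule order_trans[OF adj bound[OF that]])
    show "norm (adjoint (blinfun_apply (fst \<theta>)) v - adjoint (blinfun_apply (fst \<theta>')) v) \<le> (R + 1) * norm v * norm (\<theta> - \<theta>')" for \<theta> \<theta>' :: "('x, 'y) param" and v
      unfolding adj_diff by (rule order_trans[OF adj lip])
  qed (rule linear_adjoint)
qed

lemma affine_lipschitz_on_param_norm:
  fixes U :: "('x::euclidean_space, 'y::euclidean_space) param set"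
  assumes "affine_lipschitz_on U T"
  shows "\<exists>a\<ge>0. \<exists>a'\<ge>0. \<forall>\<theta>\<in>U. \<forall>\<theta>'\<in>U. \<forall>z.
    norm (T \<theta> z - T \<theta>' z) \<le> (a + a' * norm z) * param_norm (\<theta> - \<theta>')"
proof -
  obtain C where C: "0 \<le> C"
    "\<And>\<theta> \<theta>' z. \<theta> \<in> U \<Longrightarrow> \<theta>' \<in> U \<Longrightarrow> norm (T \<theta> z - T \<theta>' z) \<le> C * (1 + norm z) * norm (\<theta> - \<theta>')"
    by (rule affine_lipschitz_onE[OF assms]) blast
  have "norm (T \<theta> z - T \<theta>' z) \<le> (C + C * norm z) * param_norm (\<theta> - \<theta>')"
    if "\<theta> \<in> U" "\<theta>' \<in> U" for \<theta> \<theta>' z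
  proof -
    have "norm (T \<theta> z - T \<theta>' z) \<le> C * (1 + norm z) * norm (\<theta> - \<theta>')"
      using C(2) that .
    also have "\<dots> \<le> C * (1 + norm z) * param_norm (\<theta> - \<theta>')"
      using C(1) by (intro mult_left_mono norm_le_param_norm) simp
    finally show ?thesis by (simp add: algebra_simps)
  qed
  with C(1) show ?thesis by blast
qed

lemma standing_assumptionsI:
  assumes "\<And>\<theta>. \<theta> \<in> U \<Longrightarrow> Fix (T \<theta>) \<noteq> {} \<longleftrightarrow> \<theta> \<in> D_KKT K"
    and "0 < \<alpha>" "\<alpha> < 1" "0 < m" "m \<le> M"
    and G: "\<And>\<theta>. \<theta> \<in> U \<Longrightarrow> self_adjoint (G \<theta>)"
    and "\<And>\<theta>. \<theta> \<in> U \<Longrightarrow> averaged_wrt (G \<theta>) \<alpha> (T \<theta>)"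
    and m: "\<And>\<theta> z. \<theta> \<in> U \<Longrightarrow> m * (z \<bullet> z) \<le> z \<bullet> G \<theta> z"
    and M: "\<And>\<theta> z. \<theta> \<in> U \<Longrightarrow> z \<bullet> G \<theta> z \<le> M * (z \<bullet> z)"
    and "affine_lipschitz_on U T"
  shows "standing_assumptions K U T G (\<lambda>\<theta>. \<alpha>) m M"
proof -
  have "(\<lambda>z. m *\<^sub>R z) \<preceq>\<^sub>L G \<theta>" "G \<theta> \<preceq>\<^sub>L (\<lambda>z. M *\<^sub>R z)" "pos_def (G \<theta>)" if "\<theta> \<in> U" for \<theta>
    using pos_defI[OF G[OF that] \<open>0 < m\<close> m[OF that]] m[OF that] M[OF that]
    by (auto intro!: loewner_leI self_adjoint_scaleR_id G[OF that])
  with assms affine_lipschitz_on_param_norm[OF \<open>affine_lipschitz_on U T\<close>] show ?thesis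
    unfolding standing_assumptions_def by (intro conjI ballI) simp_all
qed

section \<open>ADMM and sGS-ADMM\<close>

locale admm = closed_convex_cone K + coercive_gram A \<kappa>
  for K :: "'x::euclidean_space set" and A :: "'x \<Rightarrow>\<^sub>L 'y::euclidean_space" and \<kappa> :: real +
  fixes \<sigma> \<tau> :: real
  assumes \<sigma>: "0 < \<sigma>" and \<tau>: "0 < \<tau>"
begin

lemma adjoint_y_update:
  "adjoint A (y_update \<sigma> (A, b, c) x s) =
     inverse \<sigma> *\<^sub>R op_pinv A b - P_ran A (inverse \<sigma> *\<^sub>R x + s - c)"
proof -
  have "adjoint A (y_update \<sigma> (A, b, c) x s) = op_pinv A (inverse \<sigma> *\<^sub>R b - A (inverse \<sigma> *\<^sub>R x + s - c))"
    by (simp add: op_pinv_def)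
  then show ?thesis by (simp add: pinv_linear P_ran_def)
qed

text \<open>Whatever \<open>x\<close> and \<open>s\<close> are, the dual step projects the point \<open>- z / \<sigma>\<close>, so the new slack is a
  function of \<open>z\<close> alone. This is the reason for the choice of \<open>z\<close>.\<close>

lemma s_update_z_admm:
  "s_update K \<sigma> (A, b, c) x (y_update \<sigma> (A, b, c) x s)
     = inverse \<sigma> *\<^sub>R dproj (z_admm \<sigma> (A, b, c) x s)"
proof -
  have "c - adjoint A (y_update \<sigma> (A, b, c) x s) - inverse \<sigma> *\<^sub>R x
      = - (inverse \<sigma> *\<^sub>R z_admm \<sigma> (A, b, c) x s)"
    unfolding adjoint_y_update using \<sigma> by (simp add: P_linear P_perp_def algebra_simps)
  then show ?thesis
    using dproj_scaleR[of "inverse \<sigma>" "z_admm \<sigma> (A, b, c) x s"] \<sigma>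
    by (simp del: y_update.simps z_admm.simps)
qed

text \<open>Of \<open>x\<close> only \<open>P_perp A x\<close> enters \<open>z\<close>, and \<open>P_perp A\<close> annihilates \<open>A\<^sup>* y\<close> in the multiplier step.
  Hence \<open>y\<close> is arbitrary here, and ADMM and sGS-ADMM, which differ only in the \<open>y\<close> passed to this
  step, induce the same iteration.\<close>

lemma z_admm_x_update:
  assumes s': "s' = inverse \<sigma> *\<^sub>R dproj (z_admm \<sigma> (A, b, c) x s)"
  shows "z_admm \<sigma> (A, b, c) (x_update \<sigma> \<tau> (A, b, c) x y s') s'
    = T_admm K \<sigma> \<tau> (A, b, c) (z_admm \<sigma> (A, b, c) x s)"
proof -
  define z where "z = z_admm \<sigma> (A, b, c) x s"
  have z: "z = P_perp A x + op_pinv A b - \<sigma> *\<^sub>R P_ran A s - \<sigma> *\<^sub>R P_perp A c"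
    by (simp add: z_def)
  have d: "dproj z = \<sigma> *\<^sub>R s'"
    using \<sigma> by (simp add: s' z_def)
  have p: "proj z = z + \<sigma> *\<^sub>R s'"
    using d by (simp add: dproj_eq algebra_simps)
  have Pz: "P_ran A z = op_pinv A b - \<sigma> *\<^sub>R P_ran A s"
    unfolding z by (simp add: P_linear P_ran_P_perp P_ran_op_pinv P_ran_idem)
  have "P_perp A (x_update \<sigma> \<tau> (A, b, c) x y s') = P_perp A x + (\<tau> * \<sigma>) *\<^sub>R (P_perp A s' - P_perp A c)"
    by (simp add: P_linear P_perp_adjoint)
  moreover have "T_admm K \<sigma> \<tau> (A, b, c) z
      = z - (P_ran A z + \<sigma> *\<^sub>R P_ran A s' - op_pinv A b) + (\<tau> * \<sigma>) *\<^sub>R (P_perp A s' - P_perp A c)"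
    by (simp add: d p P_linear P_ran_op_pinv algebra_simps)
  ultimately have "z_admm \<sigma> (A, b, c) (x_update \<sigma> \<tau> (A, b, c) x y s') s' = T_admm K \<sigma> \<tau> (A, b, c) z"
    unfolding Pz by (simp add: z)
  then show ?thesis by (simp add: z_def)
qed

lemma admm_step:
  assumes "admm_iterates K \<sigma> \<tau> (A, b, c) x y s"
  shows "z_admm \<sigma> (A, b, c) (x (Suc k)) (s (Suc k)) = T_admm K \<sigma> \<tau> (A, b, c) (z_admm \<sigma> (A, b, c) (x k) (s k))"
proof -
  have "s (Suc k) = inverse \<sigma> *\<^sub>R dproj (z_admm \<sigma> (A, b, c) (x k) (s k))"
    and "x (Suc k) = x_update \<sigma> \<tau> (A, b, c) (x k) (y (Suc k)) (s (Suc k))"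
    using assms s_update_z_admm by (metis admm_iterates_def)+
  then show ?thesis using z_admm_x_update by metis
qed

lemma sgs_admm_step:
  assumes "sgs_admm_iterates K \<sigma> \<tau> (A, b, c) x yh y s"
  shows "z_admm \<sigma> (A, b, c) (x (Suc k)) (s (Suc k)) = T_admm K \<sigma> \<tau> (A, b, c) (z_admm \<sigma> (A, b, c) (x k) (s k))"
proof -
  have "s (Suc k) = inverse \<sigma> *\<^sub>R dproj (z_admm \<sigma> (A, b, c) (x k) (s k))"
    and "x (Suc k) = x_update \<sigma> \<tau> (A, b, c) (x k) (y (Suc k)) (s (Suc k))"
    using assms s_update_z_admm by (metis sgs_admm_iterates_def)+
  then show ?thesis using z_admm_x_update by metis
qed

text \<open>The two displacement terms lie in orthogonal ranges, so at a fixed point both vanish. One says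
  that \<open>proj z\<close> is primal feasible, the other that \<open>dproj z / \<sigma>\<close> is a dual slack; complementarity is
  the orthogonality in Moreau's decomposition. Conversely \<open>z = x - \<sigma> s\<close> is a fixed point, because
  complementarity makes this difference the Moreau decomposition of \<open>z\<close>.\<close>

lemma Fix_T_admm_iff: "Fix (T_admm K \<sigma> \<tau> (A, b, c)) \<noteq> {} \<longleftrightarrow> (A, b, c) \<in> D_KKT K"
proof
  assume "Fix (T_admm K \<sigma> \<tau> (A, b, c)) \<noteq> {}"
  then obtain z where fixz: "T_admm K \<sigma> \<tau> (A, b, c) z = z"
    by (auto simp: Fix_def)
  define u where "u = P_ran A (proj z - op_pinv A b)"
  define v where "v = P_perp A (- dproj z + \<sigma> *\<^sub>R c)"
  have sum0: "u + \<tau> *\<^sub>R v = 0"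
    using fixz by (simp add: u_def v_def algebra_simps)
  have "P_ran A (u + \<tau> *\<^sub>R v) = u"
    by (simp add: u_def v_def P_linear P_ran_idem P_ran_P_perp)
  then have u: "u = 0" by (simp add: sum0 P_linear)
  then have v: "v = 0" using sum0 \<tau> by simp
  have feas: "A (proj z) = b"
    using arg_cong[OF u, of "blinfun_apply A"]
    by (simp add: u_def apply_P_ran apply_op_pinv blinfun.diff_right)
  define y where "y = inverse \<sigma> *\<^sub>R gram_inv A (A (\<sigma> *\<^sub>R c - dproj z))"
  define s where "s = inverse \<sigma> *\<^sub>R dproj z"
  have "\<sigma> *\<^sub>R c - dproj z = P_ran A (\<sigma> *\<^sub>R c - dproj z)"
    using v by (simp add: v_def P_perp_def)
  then have "inverse \<sigma> *\<^sub>R (\<sigma> *\<^sub>R c - dproj z) = adjoint A y"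
    by (simp add: y_def P_ran_def op_pinv_def linear_scale[OF linear_adjoint])
  then have "adjoint A y + s = c"
    using \<sigma> by (simp add: s_def scaleR_diff_right) (metis diff_add_cancel)
  moreover have "s \<in> dual_cone K" "proj z \<bullet> s = 0"
    using \<sigma> dproj_mem[of z] dproj_orthogonal[of z]
    by (auto simp: s_def dual_cone_def)
  ultimately have "(proj z, y, s) \<in> KKT K (A, b, c)"
    using feas proj_mem by simp
  then show "(A, b, c) \<in> D_KKT K" by (auto simp: D_KKT_def)
next
  assume "(A, b, c) \<in> D_KKT K"
  then obtain x y s where kkt: "A x = b" "adjoint A y + s = c" "x \<bullet> s = 0" "x \<in> K" "s \<in> dual_cone K"
    by (auto simp: D_KKT_def)
  have s: "\<sigma> *\<^sub>R s \<in> dual_cone K" "x \<bullet> (\<sigma> *\<^sub>R s) = 0"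
    using kkt \<sigma> by (auto simp: dual_cone_def)
  have "proj (x - \<sigma> *\<^sub>R s) = x" "dproj (x - \<sigma> *\<^sub>R s) = \<sigma> *\<^sub>R s"
    using proj_unique' dproj_unique kkt(4) s by blast+
  moreover have "P_ran A (x - op_pinv A b) = 0"
    using kkt(1) by (simp add: P_linear P_ran_op_pinv) (simp add: P_ran_def)
  moreover have "P_perp A (- (\<sigma> *\<^sub>R s) + \<sigma> *\<^sub>R c) = 0"
    using kkt(2)[symmetric] by (simp add: P_linear P_perp_adjoint)
  ultimately have "T_admm K \<sigma> \<tau> (A, b, c) (x - \<sigma> *\<^sub>R s) = x - \<sigma> *\<^sub>R s"
    by (simp only: T_admm.simps) simp
  then show "Fix (T_admm K \<sigma> \<tau> (A, b, c)) \<noteq> {}"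
    unfolding Fix_def by blast
qed

lemma self_adjoint_G_admm: "self_adjoint (G_admm \<tau> (A, b, c))"
proof (rule self_adjointI)
  show "linear (G_admm \<tau> (A, b, c))"
    by (simp add: linear_iff P_linear algebra_simps)
  show "G_admm \<tau> (A, b, c) u \<bullet> v = u \<bullet> G_admm \<tau> (A, b, c) v" for u v
    using P_ran_inner_same[of v u] P_ran_inner_same[of u v] P_perp_inner_same[of v u] P_perp_inner_same[of u v]
    by (simp add: inner_add inner_commute)
qed

lemma G_admm_inner:
  "u \<bullet> G_admm \<tau> (A, b, c) v = P_ran A u \<bullet> P_ran A v + inverse \<tau> * (P_perp A u \<bullet> P_perp A v)"
  by (simp add: inner_add_right P_ran_inner_same[of u v] P_perp_inner_same[of u v])

lemma G_admm_lower: "min 1 (inverse \<tau>) * (z \<bullet> z) \<le> z \<bullet> G_admm \<tau> (A, b, c) z"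
  unfolding G_admm_inner inner_decomp[of z z] distrib_left
  by (intro add_mono mult_right_mono mult_left_le_one_le inner_ge_zero) (use \<tau> in auto)

lemma G_admm_upper: "z \<bullet> G_admm \<tau> (A, b, c) z \<le> max 1 (inverse \<tau>) * (z \<bullet> z)"
  unfolding G_admm_inner inner_decomp[of z z] distrib_left
  by (intro add_mono mult_right_mono inner_ge_zero)
    (use mult_right_mono[of 1 "max 1 (inverse \<tau>)" "P_ran A z \<bullet> P_ran A z"] in auto)

text \<open>The factor \<open>1 / \<tau>\<close> in the metric compensates the relaxation \<open>\<tau>\<close> of the perpendicular component:
  with \<open>p\<close> and \<open>d\<close> the differences of the two projections, both components of
  \<open>F = P p - \<tau> P\<^sup>\<bottom> d\<close> pair with \<open>z - w = p - d\<close> to their unrelaxed squares, up to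
  \<open>- p \<bullet> d\<close>, which is nonnegative. The squared norm of \<open>F\<close> keeps one factor \<open>\<tau>\<close>, which gives
  \<open>max 1 \<tau>\<close>.\<close>

lemma averaged_T_admm: "averaged_wrt (G_admm \<tau> (A, b, c)) (1 / 2 * max 1 \<tau>) (T_admm K \<sigma> \<tau> (A, b, c))"
proof (rule averaged_wrtI[OF self_adjoint_G_admm])
  show "0 < 1 / 2 * max 1 \<tau>" by simp
  fix z w
  define p where "p = proj z - proj w"
  define d where "d = dproj z - dproj w"
  let ?a = "P_ran A p \<bullet> P_ran A p" and ?e = "P_perp A d \<bullet> P_perp A d"
  define F where "F = (z - T_admm K \<sigma> \<tau> (A, b, c) z) - (w - T_admm K \<sigma> \<tau> (A, b, c) w)"
  have F: "F = P_ran A p - \<tau> *\<^sub>R P_perp A d"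
    by (simp add: F_def p_def d_def P_linear algebra_simps)
  have PF: "P_ran A F = P_ran A p" "P_perp A F = - (\<tau> *\<^sub>R P_perp A d)"
    by (simp_all add: F P_linear P_ran_P_perp P_ran_idem P_perp_idem)
  have zw: "z - w = p - d"
    by (simp add: p_def d_def dproj_eq)
  have "F \<bullet> G_admm \<tau> (A, b, c) F = ?a + \<tau> * ?e"
    using \<tau> unfolding G_admm_inner PF by simp
  also have "\<dots> \<le> max 1 \<tau> * (?a + ?e)"
    unfolding distrib_left
    by (intro add_mono mult_right_mono inner_ge_zero)
      (use mult_right_mono[of 1 "max 1 \<tau>" ?a] in auto)
  also have "\<dots> \<le> max 1 \<tau> * ((z - w) \<bullet> G_admm \<tau> (A, b, c) F)"
  proof (rule mult_left_mono)
    have "(z - w) \<bullet> G_admm \<tau> (A, b, c) F = ?a + ?e - p \<bullet> d"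
      using \<tau> unfolding G_admm_inner PF zw inner_decomp[of p d]
      by (simp add: P_linear inner_diff inner_commute field_simps)
    then show "?a + ?e \<le> (z - w) \<bullet> G_admm \<tau> (A, b, c) F"
      using moreau_monotone[of z w] by (simp add: p_def d_def)
  qed simp
  finally show "let F = (z - T_admm K \<sigma> \<tau> (A, b, c) z) - (w - T_admm K \<sigma> \<tau> (A, b, c) w)
      in F \<bullet> G_admm \<tau> (A, b, c) F \<le> 2 * (1 / 2 * max 1 \<tau>) * ((z - w) \<bullet> G_admm \<tau> (A, b, c) F)"
    unfolding Let_def F_def[symmetric] by simp
qed

end

context closed_convex_cone
begin

lemma affine_lipschitz_on_proj:
  "affine_lipschitz_on U f \<Longrightarrow> affine_lipschitz_on U (\<lambda>\<theta> z. proj (f \<theta> z))"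
  by (erule affine_lipschitz_on_comp[where r = 1]) (simp_all add: proj_nonexpansive proj_zero)

lemma affine_lipschitz_on_T_admm:
  fixes U :: "('x, 'y::euclidean_space) param set"
  assumes U: "bounded U" and \<kappa>: "0 < \<kappa>" and coer: "\<forall>(A, b, c)\<in>U. (\<lambda>y. \<kappa> *\<^sub>R y) \<preceq>\<^sub>L gram A"
  shows "affine_lipschitz_on U (T_admm K \<sigma> \<tau>)"
proof -
  note A = linear_lipschitz_on_blinfun[OF U]
  have "linear_lipschitz_on U (\<lambda>\<theta>. gram (fst \<theta>))"
    using linear_lipschitz_on_compose[OF A] by (simp add: gram_def[abs_def])
  moreover have "\<kappa> * (v \<bullet> v) \<le> v \<bullet> gram (fst \<theta>) v" if "\<theta> \<in> U" for \<theta> v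
  proof -
    interpret coercive_gram "fst \<theta>" \<kappa>
      using that \<kappa> coer by unfold_locales auto
    show ?thesis by (rule coercive_inner)
  qed
  ultimately have "linear_lipschitz_on U (\<lambda>\<theta>. gram_inv (fst \<theta>))"
    unfolding gram_inv_def using \<kappa> by (intro linear_lipschitz_on_inv)
  from linear_lipschitz_on_compose[OF A(2) this]
  have pinv: "linear_lipschitz_on U (\<lambda>\<theta>. op_pinv (fst \<theta>))"
    by (simp add: op_pinv_def[abs_def])
  from linear_lipschitz_on_compose[OF this A(1)]
  have ran: "linear_lipschitz_on U (\<lambda>\<theta>. P_ran (fst \<theta>))"
    by (simp add: P_ran_def[abs_def])
  have dual: "affine_lipschitz_on U (\<lambda>\<theta> z. dproj z)"
    by (rule closed_convex_cone.affine_lipschitz_on_proj[OF closed_convex_cone_dual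
          affine_lipschitz_on_minus[OF affine_lipschitz_on_id]])
  have T: "T_admm K \<sigma> \<tau> = (\<lambda>\<theta> z. z - P_ran (fst \<theta>) (proj z - op_pinv (fst \<theta>) (fst (snd \<theta>)))
      - \<tau> *\<^sub>R ((- dproj z + \<sigma> *\<^sub>R snd (snd \<theta>)) - P_ran (fst \<theta>) (- dproj z + \<sigma> *\<^sub>R snd (snd \<theta>))))"
    by (simp add: fun_eq_iff split_paired_all P_perp_def)
  show ?thesis
    unfolding T
    by (intro affine_lipschitz_on_diff affine_lipschitz_on_id affine_lipschitz_on_linear[OF ran]
        affine_lipschitz_on_proj affine_lipschitz_on_linear[OF pinv] affine_lipschitz_on_data[OF U]
        affine_lipschitz_on_scaleR affine_lipschitz_on_add affine_lipschitz_on_minus dual)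
qed

end

section \<open>PDHG\<close>

locale pdhg = closed_convex_cone K
  for K :: "'x::euclidean_space set" +
  fixes A :: "'x \<Rightarrow>\<^sub>L 'y::euclidean_space" and \<eta>x \<eta>y :: real
  assumes \<eta>x: "0 < \<eta>x" and \<eta>y: "0 < \<eta>y"
begin

text \<open>Moreau's decomposition of \<open>x - \<eta>x s\<close> turns the fixed point equation of the primal step, where
  \<open>s = c - A\<^sup>* y\<close>, into the complementarity conditions.\<close>

lemma proj_fixed_iff: "proj (x - \<eta>x *\<^sub>R s) = x \<longleftrightarrow> x \<in> K \<and> s \<in> dual_cone K \<and> x \<bullet> s = 0"
proof
  assume fx: "proj (x - \<eta>x *\<^sub>R s) = x"
  have "dproj (x - \<eta>x *\<^sub>R s) = \<eta>x *\<^sub>R s"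
    using fx dproj_eq[of "x - \<eta>x *\<^sub>R s"] by simp
  with dproj_mem[of "x - \<eta>x *\<^sub>R s"] dproj_orthogonal[of "x - \<eta>x *\<^sub>R s"] proj_mem[of "x - \<eta>x *\<^sub>R s"]
  have "x \<in> K" "\<eta>x *\<^sub>R s \<in> dual_cone K" "x \<bullet> (\<eta>x *\<^sub>R s) = 0"
    using fx by auto
  then show "x \<in> K \<and> s \<in> dual_cone K \<and> x \<bullet> s = 0"
    using \<eta>x by (simp add: dual_cone_def zero_le_mult_iff)
next
  assume "x \<in> K \<and> s \<in> dual_cone K \<and> x \<bullet> s = 0"
  then show "proj (x - \<eta>x *\<^sub>R s) = x"
    using \<eta>x by (intro proj_unique') (auto simp: dual_cone_def)
qed

lemma Fix_T_pdhg_iff: "Fix (T_pdhg K \<eta>x \<eta>y (A, b, c)) \<noteq> {} \<longleftrightarrow> (A, b, c) \<in> D_KKT K"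
proof -
  have "T_pdhg K \<eta>x \<eta>y (A, b, c) (x, y) = (x, y) \<longleftrightarrow> (x, y, c - adjoint A y) \<in> KKT K (A, b, c)" for x y
  proof -
    have "T_pdhg K \<eta>x \<eta>y (A, b, c) (x, y) = (x, y) \<longleftrightarrow>
        proj (x - \<eta>x *\<^sub>R (c - adjoint A y)) = x \<and> A x = b"
      using \<eta>y by (auto simp: Let_def scaleR_2)
    then show ?thesis
      unfolding proj_fixed_iff by auto
  qed
  then have "Fix (T_pdhg K \<eta>x \<eta>y (A, b, c)) \<noteq> {} \<longleftrightarrow> (\<exists>x y. (x, y, c - adjoint A y) \<in> KKT K (A, b, c))"
    by (auto simp: Fix_def simp del: T_pdhg.simps KKT.simps)
  also have "\<dots> \<longleftrightarrow> (\<exists>x y s. (x, y, s) \<in> KKT K (A, b, c))"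
  proof -
    have "s = c - adjoint A y" if "(x, y, s) \<in> KKT K (A, b, c)" for x y s
      using that by (simp add: eq_diff_eq add.commute)
    then show ?thesis by metis
  qed
  also have "\<dots> \<longleftrightarrow> (A, b, c) \<in> D_KKT K"
    by (auto simp: D_KKT_def simp del: KKT.simps)
  finally show ?thesis .
qed

lemma self_adjoint_G_pdhg: "self_adjoint (G_pdhg \<eta>x \<eta>y (A, b, c))"
proof (rule self_adjointI)
  show "linear (G_pdhg \<eta>x \<eta>y (A, b, c))"
    by (auto simp: linear_iff linear_add[OF linear_adjoint] linear_scale[OF linear_adjoint]
        blinfun.add_right blinfun.scaleR_right algebra_simps)
  show "G_pdhg \<eta>x \<eta>y (A, b, c) u \<bullet> v = u \<bullet> G_pdhg \<eta>x \<eta>y (A, b, c) v" for u v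
    by (cases u; cases v) (simp add: inner_Pair inner_add adjoint_inner)
qed

text \<open>The map is firmly nonexpansive. In the metric \<open>G\<close>, the extrapolation \<open>2 x\<^sup>+ - x\<close> makes the
  coupling terms cancel, and only the monotonicity of the residual of the primal projection
  remains.\<close>

lemma averaged_T_pdhg: "averaged_wrt (G_pdhg \<eta>x \<eta>y (A, b, c)) (1 / 2) (T_pdhg K \<eta>x \<eta>y (A, b, c))"
proof (rule averaged_wrtI[OF self_adjoint_G_pdhg])
  show "0 < (1 / 2 :: real)" by simp
  fix z w :: "'x \<times> 'y"
  let ?T = "T_pdhg K \<eta>x \<eta>y (A, b, c)" and ?G = "G_pdhg \<eta>x \<eta>y (A, b, c)"
  define F where "F = (z - ?T z) - (w - ?T w)"
  obtain x y x' y' where zw: "z = (x, y)" "w = (x', y')" by (metis surj_pair)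
  define q where "q = x - \<eta>x *\<^sub>R (c - adjoint A y)"
  define q' where "q' = x' - \<eta>x *\<^sub>R (c - adjoint A y')"
  define p where "p = proj q - proj q'"
  define d where "d = dproj q - dproj q'"
  define h where "h = y - y' - \<eta>y *\<^sub>R A (2 *\<^sub>R p - (x - x'))"
  have qd: "q - q' = p - d"
    by (simp add: p_def d_def dproj_eq)
  then have xd: "x - x' = p - d - \<eta>x *\<^sub>R adjoint A (y - y')"
    by (simp add: q_def q'_def linear_diff[OF linear_adjoint] algebra_simps)
  have T: "?T z - ?T w = (p, h)"
    by (simp add: zw Let_def flip: q_def q'_def)
      (simp add: p_def h_def blinfun.add_right blinfun.diff_right blinfun.scaleR_right algebra_simps)
  have F: "F = (x - x' - p, y - y' - h)"
    using T by (simp add: F_def zw algebra_simps)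
  have "?G F = (inverse \<eta>x *\<^sub>R (x - x' - p) + adjoint A (y - y') - adjoint A h, A p)"
    using \<eta>y unfolding F
    by (simp add: h_def blinfun.add_right blinfun.diff_right blinfun.scaleR_right linear_diff[OF linear_adjoint]
        linear_add[OF linear_adjoint] scaleR_2 algebra_simps)
  also have "inverse \<eta>x *\<^sub>R (x - x' - p) + adjoint A (y - y') = - (inverse \<eta>x *\<^sub>R d)"
    unfolding xd using \<eta>x by (simp add: algebra_simps)
  finally have GF: "?G F = (- (inverse \<eta>x *\<^sub>R d) - adjoint A h, A p)" .
  have "(p, h) \<bullet> ?G F = - (inverse \<eta>x * (p \<bullet> d))"
    unfolding GF by (simp add: inner_Pair inner_diff_right adjoint_inner inner_commute)
  moreover have "p \<bullet> d \<le> 0"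
    using moreau_monotone[of q q'] by (simp add: p_def d_def)
  ultimately have "0 \<le> (p, h) \<bullet> ?G F"
    using \<eta>x by (simp add: mult_le_0_iff)
  moreover have "z - w = F + (p, h)"
    by (simp add: F zw)
  ultimately have "F \<bullet> ?G F \<le> 2 * (1 / 2) * ((z - w) \<bullet> ?G F)"
    by (simp add: inner_add_left del: G_pdhg.simps)
  then show "let F = (z - ?T z) - (w - ?T w) in F \<bullet> ?G F \<le> 2 * (1 / 2) * ((z - w) \<bullet> ?G F)"
    unfolding Let_def F_def[symmetric] .
qed

text \<open>In the variables \<open>x / sqrt \<eta>x\<close> and \<open>y / sqrt \<eta>y\<close> the diagonal part is the identity and the
  coupling operator has norm at most \<open>\<gamma>\<close>, so by the inequality between arithmetic and geometric
  means the coupling term is at most \<open>\<gamma>\<close> times the diagonal part.\<close>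

lemma G_pdhg_bounds:
  assumes \<gamma>: "sqrt (\<eta>x * \<eta>y) * norm A \<le> \<gamma>" "\<gamma> < 1"
  shows "(1 - \<gamma>) * inverse (max \<eta>x \<eta>y) * (z \<bullet> z) \<le> z \<bullet> G_pdhg \<eta>x \<eta>y (A, b, c) z"
    and "z \<bullet> G_pdhg \<eta>x \<eta>y (A, b, c) z \<le> (1 + \<gamma>) * inverse (min \<eta>x \<eta>y) * (z \<bullet> z)"
proof -
  obtain x y where z: "z = (x, y)" by (metis surj_pair)
  define D where "D = inverse \<eta>x * (norm x)\<^sup>2 + inverse \<eta>y * (norm y)\<^sup>2"
  have G: "z \<bullet> G_pdhg \<eta>x \<eta>y (A, b, c) z = D + 2 * (A x \<bullet> y)"
    by (simp add: z inner_Pair inner_add_right adjoint_inner D_def power2_norm_eq_inner inner_commute)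
  have zz: "z \<bullet> z = (norm x)\<^sup>2 + (norm y)\<^sup>2"
    by (simp add: z inner_Pair power2_norm_eq_inner)
  have D0: "0 \<le> D" using \<eta>x \<eta>y by (simp add: D_def)
  have coupling: "2 * \<bar>A x \<bullet> y\<bar> \<le> \<gamma> * D"
  proof -
    define r where "r = norm x / sqrt \<eta>x"
    define t where "t = norm y / sqrt \<eta>y"
    have x: "norm x = sqrt \<eta>x * r" and y: "norm y = sqrt \<eta>y * t"
      using \<eta>x \<eta>y by (simp_all add: r_def t_def)
    have D: "D = r\<^sup>2 + t\<^sup>2"
      using \<eta>x \<eta>y by (simp add: D_def r_def t_def power_divide inverse_eq_divide)
    have rt: "2 * (r * t) \<le> D" "0 \<le> r * t"
      using sum_squares_bound[of r t] \<eta>x \<eta>y by (simp_all add: D r_def t_def)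
    have "\<bar>A x \<bullet> y\<bar> \<le> norm (A x) * norm y"
      by (rule Cauchy_Schwarz_ineq2)
    also have "\<dots> \<le> norm A * norm x * norm y"
      by (intro mult_right_mono norm_blinfun) simp
    also have "\<dots> = (sqrt (\<eta>x * \<eta>y) * norm A) * (r * t)"
      by (simp add: x y real_sqrt_mult)
    also have "\<dots> \<le> \<gamma> * (r * t)"
      using \<gamma>(1) rt(2) by (rule mult_right_mono)
    finally have "2 * \<bar>A x \<bullet> y\<bar> \<le> \<gamma> * (2 * (r * t))" by simp
    also have "0 \<le> \<gamma>"
      using \<gamma>(1) \<eta>x \<eta>y by (intro order_trans[OF _ \<gamma>(1)]) simp
    then have "\<gamma> * (2 * (r * t)) \<le> \<gamma> * D"
      using rt(1) by (rule mult_left_mono[rotated])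
    finally show ?thesis .
  qed
  have \<gamma>0: "0 \<le> \<gamma>"
    using \<eta>x \<eta>y by (intro order_trans[OF _ \<gamma>(1)]) simp
  have "inverse (max \<eta>x \<eta>y) * (z \<bullet> z) \<le> D"
    unfolding zz D_def distrib_left using \<eta>x \<eta>y
    by (intro add_mono mult_right_mono) (auto intro!: le_imp_inverse_le)
  then have "(1 - \<gamma>) * (inverse (max \<eta>x \<eta>y) * (z \<bullet> z)) \<le> (1 - \<gamma>) * D"
    using \<gamma>(2) by (intro mult_left_mono) auto
  then show "(1 - \<gamma>) * inverse (max \<eta>x \<eta>y) * (z \<bullet> z) \<le> z \<bullet> G_pdhg \<eta>x \<eta>y (A, b, c) z"
    using coupling unfolding G by (simp add: left_diff_distrib mult.assoc)
  have "D \<le> inverse (min \<eta>x \<eta>y) * (z \<bullet> z)"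
    unfolding zz D_def distrib_left using \<eta>x \<eta>y
    by (intro add_mono mult_right_mono) (auto intro!: le_imp_inverse_le)
  then have "(1 + \<gamma>) * D \<le> (1 + \<gamma>) * (inverse (min \<eta>x \<eta>y) * (z \<bullet> z))"
    using \<gamma>0 by (intro mult_left_mono) auto
  then show "z \<bullet> G_pdhg \<eta>x \<eta>y (A, b, c) z \<le> (1 + \<gamma>) * inverse (min \<eta>x \<eta>y) * (z \<bullet> z)"
    using coupling unfolding G by (simp add: distrib_right mult.assoc)
qed

end

lemma (in closed_convex_cone) affine_lipschitz_on_T_pdhg:
  fixes U :: "('x, 'y::euclidean_space) param set"
  assumes U: "bounded U"
  shows "affine_lipschitz_on U (T_pdhg K \<eta>x \<eta>y)"
proof -
  note A = linear_lipschitz_on_blinfun[OF U]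
  note data = affine_lipschitz_on_data[OF U]
  define X where "X \<theta> z = proj (fst z - \<eta>x *\<^sub>R (snd (snd \<theta>) - adjoint (fst \<theta>) (snd z)))"
    for \<theta> :: "('x, 'y) param" and z
  have X: "affine_lipschitz_on U X"
    unfolding X_def
    by (intro affine_lipschitz_on_proj affine_lipschitz_on_diff affine_lipschitz_on_scaleR
        affine_lipschitz_on_fst affine_lipschitz_on_linear[OF A(2)] affine_lipschitz_on_snd data)
  have T: "T_pdhg K \<eta>x \<eta>y =
      (\<lambda>\<theta> z. (X \<theta> z, snd z + \<eta>y *\<^sub>R (fst (snd \<theta>) - fst \<theta> (2 *\<^sub>R X \<theta> z - fst z))))"
    by (simp add: fun_eq_iff split_paired_all X_def Let_def)
  show ?thesis
    unfolding T
    by (intro affine_lipschitz_on_Pair affine_lipschitz_on_add affine_lipschitz_on_diff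
        affine_lipschitz_on_scaleR affine_lipschitz_on_linear[OF A(1)] affine_lipschitz_on_fst
        affine_lipschitz_on_snd data X)
qed

section \<open>The standing assumptions for both schemes\<close>

theorem mainTheorem7:
  fixes K :: "'x::euclidean_space set"
    and \<theta>bar :: "('x, 'y::euclidean_space) param"
    and U :: "('x, 'y) param set"
  assumes "closed K" and "convex_cone K"
    and "\<theta>bar \<in> closure (D_KKT K)"
    and "compact U" and "\<theta>bar \<in> U"
  shows
    "(\<forall>\<sigma> \<tau> \<kappa>.
        0 < \<sigma> \<and> 0 < \<tau> \<and> \<tau> < 2 \<and> 0 < \<kappa> \<and> (\<forall>(A, b, c)\<in>U. (\<lambda>y. \<kappa> *\<^sub>R y) \<preceq>\<^sub>L gram A) \<longrightarrow>
        (\<forall>\<theta>\<in>U.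
           (\<forall>x y s. admm_iterates K \<sigma> \<tau> \<theta> x y s \<longrightarrow>
              (\<forall>k. z_admm \<sigma> \<theta> (x (Suc k)) (s (Suc k)) =
                    T_admm K \<sigma> \<tau> \<theta> (z_admm \<sigma> \<theta> (x k) (s k)))) \<and>
           (\<forall>x yh y s. sgs_admm_iterates K \<sigma> \<tau> \<theta> x yh y s \<longrightarrow>
              (\<forall>k. z_admm \<sigma> \<theta> (x (Suc k)) (s (Suc k)) =
                    T_admm K \<sigma> \<tau> \<theta> (z_admm \<sigma> \<theta> (x k) (s k))))) \<and>
        standing_assumptions K U (T_admm K \<sigma> \<tau>) (G_admm \<tau>)
          (\<lambda>\<theta>. 1 / 2 * max 1 \<tau>) (min 1 (inverse \<tau>)) (max 1 (inverse \<tau>)))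
     \<and>
     (\<forall>\<eta>x \<eta>y \<gamma>.
        0 < \<eta>x \<and> 0 < \<eta>y \<and> \<gamma> = (SUP (A, b, c)\<in>U. sqrt (\<eta>x * \<eta>y) * onorm (blinfun_apply A)) \<and> \<gamma> < 1 \<longrightarrow>
        standing_assumptions K U (T_pdhg K \<eta>x \<eta>y) (G_pdhg \<eta>x \<eta>y)
          (\<lambda>\<theta>. 1 / 2) ((1 - \<gamma>) * inverse (max \<eta>x \<eta>y)) ((1 + \<gamma>) * inverse (min \<eta>x \<eta>y)))"
proof (rule conjI; intro allI impI)
  interpret closed_convex_cone K
    using assms by unfold_locales
  have U: "bounded U" using assms by (simp add: compact_imp_bounded)
  {
    fix \<sigma> \<tau> \<kappa> :: real
    assume *: "0 < \<sigma> \<and> 0 < \<tau> \<and> \<tau> < 2 \<and> 0 < \<kappa> \<and> (\<forall>(A, b, c)\<in>U. (\<lambda>y. \<kappa> *\<^sub>R y) \<preceq>\<^sub>L gram A)"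
    show "(\<forall>\<theta>\<in>U.
           (\<forall>x y s. admm_iterates K \<sigma> \<tau> \<theta> x y s \<longrightarrow>
              (\<forall>k. z_admm \<sigma> \<theta> (x (Suc k)) (s (Suc k)) =
                    T_admm K \<sigma> \<tau> \<theta> (z_admm \<sigma> \<theta> (x k) (s k)))) \<and>
           (\<forall>x yh y s. sgs_admm_iterates K \<sigma> \<tau> \<theta> x yh y s \<longrightarrow>
              (\<forall>k. z_admm \<sigma> \<theta> (x (Suc k)) (s (Suc k)) =
                    T_admm K \<sigma> \<tau> \<theta> (z_admm \<sigma> \<theta> (x k) (s k))))) \<and>
        standing_assumptions K U (T_admm K \<sigma> \<tau>) (G_admm \<tau>)
          (\<lambda>\<theta>. 1 / 2 * max 1 \<tau>) (min 1 (inverse \<tau>)) (max 1 (inverse \<tau>))"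
    proof (intro conjI ballI allI impI)
      fix \<theta> :: "('x, 'y) param" and x s :: "nat \<Rightarrow> 'x" and y :: "nat \<Rightarrow> 'y" and k
      assume \<theta>: "\<theta> \<in> U" "admm_iterates K \<sigma> \<tau> \<theta> x y s"
      obtain A b c where eq: "\<theta> = (A, b, c)" by (metis surj_pair)
      interpret admm K A \<kappa> \<sigma> \<tau>
        using * \<theta>(1) by unfold_locales (auto simp: eq)
      show "z_admm \<sigma> \<theta> (x (Suc k)) (s (Suc k)) = T_admm K \<sigma> \<tau> \<theta> (z_admm \<sigma> \<theta> (x k) (s k))"
        using admm_step \<theta>(2) unfolding eq .
    next
      fix \<theta> :: "('x, 'y) param" and x s :: "nat \<Rightarrow> 'x" and yh y :: "nat \<Rightarrow> 'y" and k
      assume \<theta>: "\<theta> \<in> U" "sgs_admm_iterates K \<sigma> \<tau> \<theta> x yh y s"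
      obtain A b c where eq: "\<theta> = (A, b, c)" by (metis surj_pair)
      interpret admm K A \<kappa> \<sigma> \<tau>
        using * \<theta>(1) by unfold_locales (auto simp: eq)
      show "z_admm \<sigma> \<theta> (x (Suc k)) (s (Suc k)) = T_admm K \<sigma> \<tau> \<theta> (z_admm \<sigma> \<theta> (x k) (s k))"
        using sgs_admm_step \<theta>(2) unfolding eq .
    next
      show "standing_assumptions K U (T_admm K \<sigma> \<tau>) (G_admm \<tau>)
          (\<lambda>\<theta>. 1 / 2 * max 1 \<tau>) (min 1 (inverse \<tau>)) (max 1 (inverse \<tau>))"
      proof (rule standing_assumptionsI)
        show "affine_lipschitz_on U (T_admm K \<sigma> \<tau>)"
          using * affine_lipschitz_on_T_admm[OF U, of \<kappa>] by blast
        fix \<theta> assume \<theta>: "\<theta> \<in> U"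
        obtain A b c where eq: "\<theta> = (A, b, c)" by (metis surj_pair)
        interpret admm K A \<kappa> \<sigma> \<tau>
          using * \<theta> by unfold_locales (auto simp: eq)
        show "Fix (T_admm K \<sigma> \<tau> \<theta>) \<noteq> {} \<longleftrightarrow> \<theta> \<in> D_KKT K"
          using Fix_T_admm_iff[of b c] by (simp add: eq del: G_admm.simps T_admm.simps G_pdhg.simps T_pdhg.simps)
        show "self_adjoint (G_admm \<tau> \<theta>)"
          using self_adjoint_G_admm[of b c] by (simp add: eq del: G_admm.simps T_admm.simps G_pdhg.simps T_pdhg.simps)
        show "averaged_wrt (G_admm \<tau> \<theta>) (1 / 2 * max 1 \<tau>) (T_admm K \<sigma> \<tau> \<theta>)"
          using averaged_T_admm[of b c] by (simp add: eq del: G_admm.simps T_admm.simps G_pdhg.simps T_pdhg.simps)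
        show "min 1 (inverse \<tau>) * (z \<bullet> z) \<le> z \<bullet> G_admm \<tau> \<theta> z" for z
          using G_admm_lower[of z b c] by (simp add: eq del: G_admm.simps T_admm.simps G_pdhg.simps T_pdhg.simps)
        show "z \<bullet> G_admm \<tau> \<theta> z \<le> max 1 (inverse \<tau>) * (z \<bullet> z)" for z
          using G_admm_upper[of z b c] by (simp add: eq del: G_admm.simps T_admm.simps G_pdhg.simps T_pdhg.simps)
      qed (use * in auto)
    qed
  }
  {
    fix \<eta>x \<eta>y \<gamma> :: real
    assume *: "0 < \<eta>x \<and> 0 < \<eta>y \<and>
      \<gamma> = (SUP (A, b, c)\<in>U. sqrt (\<eta>x * \<eta>y) * onorm (blinfun_apply A)) \<and> \<gamma> < 1"
    have \<gamma>_eq: "\<gamma> = (SUP \<theta>\<in>U. sqrt (\<eta>x * \<eta>y) * norm (fst \<theta>))"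
      using * by (simp add: case_prod_unfold norm_blinfun.rep_eq)
    have "bdd_above ((\<lambda>\<theta>. sqrt (\<eta>x * \<eta>y) * norm (fst \<theta>)) ` U)"
    proof -
      obtain R where "\<And>\<theta>. \<theta> \<in> U \<Longrightarrow> norm \<theta> \<le> R"
        using U by (auto simp: bounded_iff)
      then have "norm (fst \<theta>) \<le> R" if "\<theta> \<in> U" for \<theta>
        using that norm_fst_snd_le(1) order_trans by blast
      then show ?thesis
        using * by (intro bdd_aboveI2[of _ _ "sqrt (\<eta>x * \<eta>y) * R"] mult_left_mono) auto
    qed
    then have \<gamma>: "sqrt (\<eta>x * \<eta>y) * norm (fst \<theta>) \<le> \<gamma>" if "\<theta> \<in> U" for \<theta>
      unfolding \<gamma>_eq using that by (intro cSUP_upper)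
    have \<gamma>0: "0 \<le> \<gamma>"
      using * by (intro order_trans[OF _ \<gamma>[OF assms(5)]]) simp
    show "standing_assumptions K U (T_pdhg K \<eta>x \<eta>y) (G_pdhg \<eta>x \<eta>y)
          (\<lambda>\<theta>. 1 / 2) ((1 - \<gamma>) * inverse (max \<eta>x \<eta>y)) ((1 + \<gamma>) * inverse (min \<eta>x \<eta>y))"
    proof (rule standing_assumptionsI)
      show "affine_lipschitz_on U (T_pdhg K \<eta>x \<eta>y)"
        by (rule affine_lipschitz_on_T_pdhg[OF U])
      show "0 < (1 - \<gamma>) * inverse (max \<eta>x \<eta>y)"
        using * by (intro mult_pos_pos) auto
      show "(1 - \<gamma>) * inverse (max \<eta>x \<eta>y) \<le> (1 + \<gamma>) * inverse (min \<eta>x \<eta>y)"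
        using * \<gamma>0 by (intro mult_mono le_imp_inverse_le) auto
      fix \<theta> assume \<theta>: "\<theta> \<in> U"
      obtain A b c where eq: "\<theta> = (A, b, c)" by (metis surj_pair)
      interpret pdhg K A \<eta>x \<eta>y
        using * by unfold_locales auto
      have \<gamma>A: "sqrt (\<eta>x * \<eta>y) * norm A \<le> \<gamma>" "\<gamma> < 1"
        using \<gamma>[OF \<theta>] * by (simp_all add: eq)
      show "Fix (T_pdhg K \<eta>x \<eta>y \<theta>) \<noteq> {} \<longleftrightarrow> \<theta> \<in> D_KKT K"
        using Fix_T_pdhg_iff[of b c] by (simp add: eq del: G_admm.simps T_admm.simps G_pdhg.simps T_pdhg.simps)
      show "self_adjoint (G_pdhg \<eta>x \<eta>y \<theta>)"
        using self_adjoint_G_pdhg[of b c] by (simp add: eq del: G_admm.simps T_admm.simps G_pdhg.simps T_pdhg.simps)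
      show "averaged_wrt (G_pdhg \<eta>x \<eta>y \<theta>) (1 / 2) (T_pdhg K \<eta>x \<eta>y \<theta>)"
        using averaged_T_pdhg[of b c] by (simp add: eq del: G_admm.simps T_admm.simps G_pdhg.simps T_pdhg.simps)
      show "(1 - \<gamma>) * inverse (max \<eta>x \<eta>y) * (z \<bullet> z) \<le> z \<bullet> G_pdhg \<eta>x \<eta>y \<theta> z" for z
        using G_pdhg_bounds(1)[OF \<gamma>A, of z b c] by (simp add: eq)
      show "z \<bullet> G_pdhg \<eta>x \<eta>y \<theta> z \<le> (1 + \<gamma>) * inverse (min \<eta>x \<eta>y) * (z \<bullet> z)" for z
        using G_pdhg_bounds(2)[OF \<gamma>A, of z b c] by (simp add: eq)
    qed auto
  }
qed

end
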